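(* Let $S$ be an extension of $\mathrm{HA}^\omega$ with a base interpretation of $\mathcal L_S^{\mathcal I}$ that uses the bounding interpretation at the ground type $\mathbb N$. Suppose that the $B$-restricted quantifiers, for a formula $B(x^\sigma,\boldsymbol y)$, are semi-uniform and that $C(x,n^{\mathbb N})$ is an arbitrary formula of the source language. Then the principle $$\forall x\lhd_\sigma B(\boldsymbol y)\,\exists n^{\mathbb N}\,C(x,n)\ \to\ \exists k^{\mathbb N}\,\forall x\lhd_\sigma B(\boldsymbol y)\,\exists n\le k\,C(x,n)$$ is $\mathcal I$-interpretable.
   Context: Source. $\mathrm{HA}^\omega$ is Heyting arithmetic in all finite types generated by $\sigma\to\tau$ from ground types including $\mathbb N$ and $\mathbb B$, with combinators, $0$, successor, recursors, Boolean constants and conditionals, logical equalities $\equiv_\sigma$ at all types, and the usual axioms; $S$ is an extension of it (possibly with further types, constants, relation symbols and axioms) in the language $\mathcal L_S$. Formulas use $\bot,\wedge,\to,\forall x^\sigma,\exists x^\sigma$ and restricted quantifiers (below). $n\le k$ abbreviates a quantifier-free equation of type $\mathbb N$. Target. The target theory $T$ has types and terms including those of $\mathcal L_S$, and witnessing types, including $\mathbb N$, closed under $\rho\to\tau$ and $\rho^*$ (non-empty finite subsets), with combinators, recursors, singleton, union, indexed union, membership and the maximum functional $\mathrm m:\mathbb N^*\to\mathbb N$; it proves the usual elementary facts about these, natural numbers and equality (e.g. $T$ may be the set of truths in the full set-theoretic structure). Boldface letters are (possibly empty) tuples; $\forall\boldsymbol b\in\boldsymbol B$ is componentwise. $\mathcal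 L_S^{\mathcal I}$ adds a unary predicate $\mathcal I_\sigma(x^\sigma)$ for each type. A base interpretation assigns to each relation symbol $R$ tuples of witnessing types $\boldsymbol\tau_R^+,\boldsymbol\tau_R^-$ and a relation $\langle R(\boldsymbol x)\rangle^{\boldsymbol c}_{\boldsymbol d}$ of the target language ($\boldsymbol c:\boldsymbol\tau_R^+$, $\boldsymbol d:\boldsymbol\tau_R^-$); $\langle x\equiv_\sigma y\rangle$ is $x=y$ without witnesses. It uses the bounding interpretation at $\mathbb N$: $\langle\mathcal I_{\mathbb N}(x)\rangle^m$ is $x\le m$ ($m:\mathbb N$, no negative witnesses). $\mathcal U$-interpretation: $\langle\bot\rangle:\equiv\bot$; $\langle A\wedge B\rangle^{\boldsymbol a,\boldsymbol c}_{\boldsymbol b,\boldsymbol d}:\equiv\langle A\rangle^{\boldsymbol a}_{\boldsymbol b}\wedge\langle B\rangle^{\boldsymbol c}_{\boldsymbol d}$; $\langle A\to B\rangle^{\boldsymbol f,\boldsymbol g}_{\boldsymbol a,\boldsymbol d}:\equiv\forall\boldsymbol b\in\boldsymbol g\boldsymbol a\boldsymbol d\,\langle A\rangle^{\boldsymbol a}_{\boldsymbol b}\to\langle B\rangle^{\boldsymbol f\boldsymbol a}_{\boldsymbol d}$; $\langle\forall xA\rangle^{\boldsymbol a}_{\boldsymbol b}:\equiv\forall x\langle A\rangle^{\boldsymbol a}_{\boldsymbol b}$; $\langle\exists xA\rangle^{\boldsymbol a}_{\boldsymbol B}:\equiv\exists x\forall\boldsymbol b\in\boldsymbol B\langle A\rangle^{\boldsymbol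 a}_{\boldsymbol b}$. $A(\boldsymbol x)$ is $\mathcal U$-interpretable if there are closed witnessing terms $\boldsymbol t$ with $T\vdash\forall\boldsymbol b\langle A(\boldsymbol x)\rangle^{\boldsymbol t}_{\boldsymbol b}$. Restricted quantifiers. For a formula $B(x^\sigma,\boldsymbol y)$ there are primitive quantifiers $\forall x\lhd_\sigma B(\boldsymbol y)\,A(x)$, $\exists x\lhd_\sigma B(\boldsymbol y)\,A(x)$ with axioms stating their equivalence with $\forall x^\sigma(B(x,\boldsymbol y)\to A(x))$, $\exists x^\sigma(B(x,\boldsymbol y)\wedge A(x))$. The bounded quantifier $\exists n\le k$ is the restricted quantifier for the formula $n\le k$. Relativization $A^{\mathcal I}$ commutes with connectives, $(\forall x^\sigma A)^{\mathcal I}:\equiv\forall x^\sigma(\mathcal I_\sigma(x)\to A^{\mathcal I})$, $(\exists x^\sigma A)^{\mathcal I}:\equiv\exists x^\sigma(\mathcal I_\sigma(x)\wedge A^{\mathcal I})$, $(\forall x\lhd_\sigma B(\boldsymbol y)A)^{\mathcal I}:\equiv\forall x^\sigma(B(x,\boldsymbol y)^{\mathcal I}\to A^{\mathcal I})$, $(\exists x\lhd_\sigma B(\boldsymbol y)A)^{\mathcal I}:\equiv\exists x^\sigma(B(x,\boldsymbol y)^{\mathcal I}\wedge A^{\mathcal I})$. Put $|A|^{\boldsymbol a}_{\boldsymbol b}:\equiv\langle A^{\mathcal I}\rangle^{\boldsymbol a}_{\boldsymbol b}$; $\boldsymbol a$ are the positive and $\boldsymbol b$ the negative $\mathcal I$-witnesses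 of $A$. A formula $A(\boldsymbol x)$ is $\mathcal I$-interpretable if $\forall\boldsymbol x(\mathcal I(\boldsymbol x)\to A(\boldsymbol x)^{\mathcal I})$ is $\mathcal U$-interpretable. $B(x^\sigma,\boldsymbol y^{\boldsymbol\tau})$ subsumes $\mathcal I_\sigma(x)$ if $\forall\boldsymbol y(\mathcal I_{\boldsymbol\tau}(\boldsymbol y)\to\forall x^\sigma(B(x,\boldsymbol y)^{\mathcal I}\to\mathcal I_\sigma(x)))$ is $\mathcal U$-interpretable. The $B$-restricted quantifiers are semi-uniform if $B$ subsumes $\mathcal I_\sigma(x)$ and $B$ has no positive $\mathcal I$-witnesses (the tuple of positive witnesses of $|B(x,\boldsymbol y)|$ is empty).
   Formalization: Every witnessing type is assumed to have a closed witnessing term (automatic for types generated from N); otherwise vacuous negative witnesses of I(y) may have no closed realizer and the claim can fail. *)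

theory Defs
  imports Main
begin

section \<open>Types, terms and formulas\<close>

text \<open>
  One syntax serves the source language, its extension by the predicates \<open>\<I>\<close>, and the target
  language; which types, constants and relation symbols belong to a language is recorded in the
  record \<open>lang\<close> below. Further types of a language are ground types \<open>Ground\<close>; further constants
  carry their type and further relation symbols carry their arity.
\<close>

datatype 'g ty =
    NatT | BoolT | Ground 'g
  | Fun "'g ty" "'g ty"  (infixr "\<rightarrow>\<^sub>t" 65)
  | Star "'g ty"

abbreviation Funs :: "'g ty list \<Rightarrow> 'g ty \<Rightarrow> 'g ty" where
  "Funs \<sigma>s \<tau> \<equiv> foldr Fun \<sigma>s \<tau>"

datatype ('g, 'c) const =
    CombK "'g ty" "'g ty" | CombS "'g ty" "'g ty" "'g ty"
  | Zero | Succ | Rec "'g ty"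
  | TT | FF | Cond "'g ty"
  | Sing "'g ty" | Union2 "'g ty" | UnionI "'g ty" "'g ty" | MaxN
  | OtherC 'c "'g ty"

primrec ctype :: "('g, 'c) const \<Rightarrow> 'g ty" where
  "ctype (CombK \<sigma> \<tau>) = \<sigma> \<rightarrow>\<^sub>t \<tau> \<rightarrow>\<^sub>t \<sigma>"
| "ctype (CombS \<rho> \<sigma> \<tau>) = (\<rho> \<rightarrow>\<^sub>t \<sigma> \<rightarrow>\<^sub>t \<tau>) \<rightarrow>\<^sub>t (\<rho> \<rightarrow>\<^sub>t \<sigma>) \<rightarrow>\<^sub>t \<rho> \<rightarrow>\<^sub>t \<tau>"
| "ctype Zero = NatT"
| "ctype Succ = NatT \<rightarrow>\<^sub>t NatT"
| "ctype (Rec \<sigma>) = \<sigma> \<rightarrow>\<^sub>t (NatT \<rightarrow>\<^sub>t \<sigma> \<rightarrow>\<^sub>t \<sigma>) \<rightarrow>\<^sub>t NatT \<rightarrow>\<^sub>t \<sigma>"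
| "ctype TT = BoolT"
| "ctype FF = BoolT"
| "ctype (Cond \<sigma>) = BoolT \<rightarrow>\<^sub>t \<sigma> \<rightarrow>\<^sub>t \<sigma> \<rightarrow>\<^sub>t \<sigma>"
| "ctype (Sing \<sigma>) = \<sigma> \<rightarrow>\<^sub>t Star \<sigma>"
| "ctype (Union2 \<sigma>) = Star \<sigma> \<rightarrow>\<^sub>t Star \<sigma> \<rightarrow>\<^sub>t Star \<sigma>"
| "ctype (UnionI \<rho> \<sigma>) = Star \<rho> \<rightarrow>\<^sub>t (\<rho> \<rightarrow>\<^sub>t Star \<sigma>) \<rightarrow>\<^sub>t Star \<sigma>"
| "ctype MaxN = Star NatT \<rightarrow>\<^sub>t NatT"
| "ctype (OtherC c \<sigma>) = \<sigma>"

datatype ('g, 'c) tm =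
    Var nat  \<comment> \<open>de Bruijn index\<close>
  | Con "('g, 'c) const"
  | App "('g, 'c) tm" "('g, 'c) tm"  (infixl "\<bullet>" 85)

abbreviation Apps :: "('g, 'c) tm \<Rightarrow> ('g, 'c) tm list \<Rightarrow> ('g, 'c) tm" where
  "Apps t ts \<equiv> foldl App t ts"

datatype ('g, 'r) rel =
    Sym 'r "'g ty list"
  | IPred "'g ty"
  | Mem "'g ty"

primrec arity :: "('g, 'r) rel \<Rightarrow> 'g ty list" where
  "arity (Sym r \<sigma>s) = \<sigma>s"
| "arity (IPred \<sigma>) = [\<sigma>]"
| "arity (Mem \<sigma>) = [\<sigma>, Star \<sigma>]"

text \<open>\<open>RAll \<sigma> B A\<close> and \<open>REx \<sigma> B A\<close> are the restricted quantifiers; they bind index 0 in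
  both \<open>B\<close> and \<open>A\<close>, the parameters of \<open>B\<close> being its other free variables.\<close>

datatype ('g, 'c, 'r) form =
    Bot
  | Eq "'g ty" "('g, 'c) tm" "('g, 'c) tm"
  | Rel "('g, 'r) rel" "('g, 'c) tm list"
  | And "('g, 'c, 'r) form" "('g, 'c, 'r) form"
  | Imp "('g, 'c, 'r) form" "('g, 'c, 'r) form"
  | All "'g ty" "('g, 'c, 'r) form"
  | Ex "'g ty" "('g, 'c, 'r) form"
  | RAll "'g ty" "('g, 'c, 'r) form" "('g, 'c, 'r) form"
  | REx "'g ty" "('g, 'c, 'r) form" "('g, 'c, 'r) form"


section \<open>Substitution\<close>

primrec tsub :: "(nat \<Rightarrow> ('g, 'c) tm) \<Rightarrow> ('g, 'c) tm \<Rightarrow> ('g, 'c) tm" where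
  "tsub e (Var i) = e i"
| "tsub e (Con c) = Con c"
| "tsub e (App s t) = App (tsub e s) (tsub e t)"

definition lift :: "nat \<Rightarrow> ('g, 'c) tm \<Rightarrow> ('g, 'c) tm" where
  "lift n = tsub (\<lambda>i. Var (i + n))"

definition up :: "(nat \<Rightarrow> ('g, 'c) tm) \<Rightarrow> nat \<Rightarrow> ('g, 'c) tm" where
  "up e = case_nat (Var 0) (\<lambda>i. lift 1 (e i))"

primrec fsub :: "(nat \<Rightarrow> ('g, 'c) tm) \<Rightarrow> ('g, 'c, 'r) form \<Rightarrow> ('g, 'c, 'r) form" where
  "fsub e Bot = Bot"
| "fsub e (Eq \<sigma> s t) = Eq \<sigma> (tsub e s) (tsub e t)"
| "fsub e (Rel R ts) = Rel R (map (tsub e) ts)"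
| "fsub e (And A B) = And (fsub e A) (fsub e B)"
| "fsub e (Imp A B) = Imp (fsub e A) (fsub e B)"
| "fsub e (All \<sigma> A) = All \<sigma> (fsub (up e) A)"
| "fsub e (Ex \<sigma> A) = Ex \<sigma> (fsub (up e) A)"
| "fsub e (RAll \<sigma> B A) = RAll \<sigma> (fsub (up e) B) (fsub (up e) A)"
| "fsub e (REx \<sigma> B A) = REx \<sigma> (fsub (up e) B) (fsub (up e) A)"

text \<open>\<open>weaken m A\<close> makes room for a new variable with index \<open>m\<close>. \<open>put n t A\<close> replaces index 0 by
  \<open>t\<close> and places the result under \<open>n\<close> new binders.\<close>

definition weaken :: "nat \<Rightarrow> ('g, 'c, 'r) form \<Rightarrow> ('g, 'c, 'r) form" where
  "weaken m = fsub (\<lambda>i. Var (if i < m then i else Suc i))"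

definition put :: "nat \<Rightarrow> ('g, 'c) tm \<Rightarrow> ('g, 'c, 'r) form \<Rightarrow> ('g, 'c, 'r) form" where
  "put n t = fsub (case_nat t (\<lambda>i. Var (i + n)))"


section \<open>Defined formulas\<close>

definition Top :: "('g, 'c, 'r) form" where
  "Top = Imp Bot Bot"

definition Iff :: "('g, 'c, 'r) form \<Rightarrow> ('g, 'c, 'r) form \<Rightarrow> ('g, 'c, 'r) form" where
  "Iff A B = And (Imp A B) (Imp B A)"

text \<open>Disjunction is definable in arithmetic.\<close>

definition Or :: "('g, 'c, 'r) form \<Rightarrow> ('g, 'c, 'r) form \<Rightarrow> ('g, 'c, 'r) form" where
  "Or A B = Ex NatT (And (Imp (Eq NatT (Var 0) (Con Zero)) (weaken 0 A))
                         (Imp (Imp (Eq NatT (Var 0) (Con Zero)) Bot) (weaken 0 B)))"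

fun Conjs :: "('g, 'c, 'r) form list \<Rightarrow> ('g, 'c, 'r) form" where
  "Conjs [] = Top"
| "Conjs [A] = A"
| "Conjs (A # B # As) = And A (Conjs (B # As))"

text \<open>Contexts are lists of types, the type of index 0 first.\<close>

primrec Alls :: "'g ty list \<Rightarrow> ('g, 'c, 'r) form \<Rightarrow> ('g, 'c, 'r) form" where
  "Alls [] A = A"
| "Alls (\<sigma> # \<Gamma>) A = Alls \<Gamma> (All \<sigma> A)"

text \<open>\<open>n \<le> k\<close> is the equation \<open>n \<dotminus> k = 0\<close>, with truncated subtraction by recursion on \<open>k\<close>.\<close>

definition predecessor :: "('g, 'c) tm" where
  "predecessor = Con (Rec NatT) \<bullet> Con Zero \<bullet> Con (CombK NatT NatT)"

definition monus :: "('g, 'c) tm \<Rightarrow> ('g, 'c) tm \<Rightarrow> ('g, 'c) tm" where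
  "monus n k = Con (Rec NatT) \<bullet> n \<bullet> (Con (CombK (NatT \<rightarrow>\<^sub>t NatT) NatT) \<bullet> predecessor) \<bullet> k"

definition Le :: "('g, 'c) tm \<Rightarrow> ('g, 'c) tm \<Rightarrow> ('g, 'c, 'r) form" where
  "Le n k = Eq NatT (monus n k) (Con Zero)"


section \<open>Languages\<close>

record ('g, 'c, 'r) lang =
  types :: "'g ty set"
  constants :: "('g, 'c) const set"
  rels :: "('g, 'r) rel set"
  restricted :: bool  \<comment> \<open>whether formulas may contain restricted quantifiers\<close>

inductive typing :: "('g, 'c, 'r) lang \<Rightarrow> 'g ty list \<Rightarrow> ('g, 'c) tm \<Rightarrow> 'g ty \<Rightarrow> bool"
  for L :: "('g, 'c, 'r) lang" and \<Gamma> :: "'g ty list" where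
  "i < length \<Gamma> \<Longrightarrow> typing L \<Gamma> (Var i) (\<Gamma> ! i)"
| "c \<in> constants L \<Longrightarrow> typing L \<Gamma> (Con c) (ctype c)"
| "typing L \<Gamma> s (\<sigma> \<rightarrow>\<^sub>t \<tau>) \<Longrightarrow> typing L \<Gamma> t \<sigma> \<Longrightarrow> typing L \<Gamma> (s \<bullet> t) \<tau>"

primrec wf_form :: "('g, 'c, 'r) lang \<Rightarrow> 'g ty list \<Rightarrow> ('g, 'c, 'r) form \<Rightarrow> bool" where
  "wf_form L \<Gamma> Bot \<longleftrightarrow> True"
| "wf_form L \<Gamma> (Eq \<sigma> s t) \<longleftrightarrow> \<sigma> \<in> types L \<and> typing L \<Gamma> s \<sigma> \<and> typing L \<Gamma> t \<sigma>"
| "wf_form L \<Gamma> (Rel R ts) \<longleftrightarrow> R \<in> rels L \<and> list_all2 (typing L \<Gamma>) ts (arity R)"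
| "wf_form L \<Gamma> (And A B) \<longleftrightarrow> wf_form L \<Gamma> A \<and> wf_form L \<Gamma> B"
| "wf_form L \<Gamma> (Imp A B) \<longleftrightarrow> wf_form L \<Gamma> A \<and> wf_form L \<Gamma> B"
| "wf_form L \<Gamma> (All \<sigma> A) \<longleftrightarrow> \<sigma> \<in> types L \<and> wf_form L (\<sigma> # \<Gamma>) A"
| "wf_form L \<Gamma> (Ex \<sigma> A) \<longleftrightarrow> \<sigma> \<in> types L \<and> wf_form L (\<sigma> # \<Gamma>) A"
| "wf_form L \<Gamma> (RAll \<sigma> B A) \<longleftrightarrow>
     restricted L \<and> \<sigma> \<in> types L \<and> wf_form L (\<sigma> # \<Gamma>) B \<and> wf_form L (\<sigma> # \<Gamma>) A"
| "wf_form L \<Gamma> (REx \<sigma> B A) \<longleftrightarrow>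
     restricted L \<and> \<sigma> \<in> types L \<and> wf_form L (\<sigma> # \<Gamma>) B \<and> wf_form L (\<sigma> # \<Gamma>) A"

definition lang_ok :: "('g, 'c, 'r) lang \<Rightarrow> bool" where
  "lang_ok L \<longleftrightarrow>
     (\<forall>c\<in>constants L. ctype c \<in> types L) \<and>
     (\<forall>R\<in>rels L. set (arity R) \<subseteq> types L) \<and>
     (\<forall>\<sigma> \<tau>. \<sigma> \<rightarrow>\<^sub>t \<tau> \<in> types L \<longrightarrow> \<sigma> \<in> types L \<and> \<tau> \<in> types L) \<and>
     (\<forall>\<sigma>. Star \<sigma> \<in> types L \<longrightarrow> \<sigma> \<in> types L)"


section \<open>The source theory\<close>

text \<open>The nonlogical axioms of \<open>HA\<^sup>\<omega>\<close> and those for equality, as closed formulas over the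
  types and constants of an arbitrary language. Schemes are universally closed by \<open>Alls \<Gamma>\<close>.\<close>

inductive_set HA_axioms :: "('g, 'c, 'r) lang \<Rightarrow> ('g, 'c, 'r) form set"
  for L :: "('g, 'c, 'r) lang" where
  eq_refl: "\<sigma> \<in> types L \<Longrightarrow> All \<sigma> (Eq \<sigma> (Var 0) (Var 0)) \<in> HA_axioms L"
| eq_subst: "set \<Gamma> \<subseteq> types L \<Longrightarrow> \<sigma> \<in> types L \<Longrightarrow> wf_form L (\<sigma> # \<Gamma>) A \<Longrightarrow>
    Alls \<Gamma> (All \<sigma> (All \<sigma> (Imp (Eq \<sigma> (Var 1) (Var 0))
      (Imp (put 2 (Var 1) A) (put 2 (Var 0) A))))) \<in> HA_axioms L"
| combK: "CombK \<sigma> \<tau> \<in> constants L \<Longrightarrow>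
    All \<sigma> (All \<tau> (Eq \<sigma> (Con (CombK \<sigma> \<tau>) \<bullet> Var 1 \<bullet> Var 0) (Var 1))) \<in> HA_axioms L"
| combS: "CombS \<rho> \<sigma> \<tau> \<in> constants L \<Longrightarrow>
    All (\<rho> \<rightarrow>\<^sub>t \<sigma> \<rightarrow>\<^sub>t \<tau>) (All (\<rho> \<rightarrow>\<^sub>t \<sigma>) (All \<rho>
      (Eq \<tau> (Con (CombS \<rho> \<sigma> \<tau>) \<bullet> Var 2 \<bullet> Var 1 \<bullet> Var 0)
             (Var 2 \<bullet> Var 0 \<bullet> (Var 1 \<bullet> Var 0))))) \<in> HA_axioms L"
| succ_inj: "All NatT (All NatT (Imp (Eq NatT (Con Succ \<bullet> Var 1) (Con Succ \<bullet> Var 0))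
      (Eq NatT (Var 1) (Var 0)))) \<in> HA_axioms L"
| succ_zero: "All NatT (Imp (Eq NatT (Con Succ \<bullet> Var 0) (Con Zero)) Bot) \<in> HA_axioms L"
| induction: "set \<Gamma> \<subseteq> types L \<Longrightarrow> wf_form L (NatT # \<Gamma>) A \<Longrightarrow>
    Alls \<Gamma> (Imp (put 0 (Con Zero) A)
      (Imp (All NatT (Imp A (put 1 (Con Succ \<bullet> Var 0) A))) (All NatT A))) \<in> HA_axioms L"
| rec_zero: "Rec \<sigma> \<in> constants L \<Longrightarrow>
    All \<sigma> (All (NatT \<rightarrow>\<^sub>t \<sigma> \<rightarrow>\<^sub>t \<sigma>)
      (Eq \<sigma> (Con (Rec \<sigma>) \<bullet> Var 1 \<bullet> Var 0 \<bullet> Con Zero) (Var 1))) \<in> HA_axioms L"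
| rec_succ: "Rec \<sigma> \<in> constants L \<Longrightarrow>
    All \<sigma> (All (NatT \<rightarrow>\<^sub>t \<sigma> \<rightarrow>\<^sub>t \<sigma>) (All NatT
      (Eq \<sigma> (Con (Rec \<sigma>) \<bullet> Var 2 \<bullet> Var 1 \<bullet> (Con Succ \<bullet> Var 0))
             (Var 1 \<bullet> Var 0 \<bullet> (Con (Rec \<sigma>) \<bullet> Var 2 \<bullet> Var 1 \<bullet> Var 0))))) \<in> HA_axioms L"
| bool_distinct: "Imp (Eq BoolT (Con TT) (Con FF)) Bot \<in> HA_axioms L"
| bool_cases: "set \<Gamma> \<subseteq> types L \<Longrightarrow> wf_form L (BoolT # \<Gamma>) A \<Longrightarrow>
    Alls \<Gamma> (Imp (put 0 (Con TT) A) (Imp (put 0 (Con FF) A) (All BoolT A))) \<in> HA_axioms L"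
| cond_true: "Cond \<sigma> \<in> constants L \<Longrightarrow>
    All \<sigma> (All \<sigma> (Eq \<sigma> (Con (Cond \<sigma>) \<bullet> Con TT \<bullet> Var 1 \<bullet> Var 0) (Var 1))) \<in> HA_axioms L"
| cond_false: "Cond \<sigma> \<in> constants L \<Longrightarrow>
    All \<sigma> (All \<sigma> (Eq \<sigma> (Con (Cond \<sigma>) \<bullet> Con FF \<bullet> Var 1 \<bullet> Var 0) (Var 0))) \<in> HA_axioms L"

inductive_set restricted_axioms :: "('g, 'c, 'r) lang \<Rightarrow> ('g, 'c, 'r) form set"
  for L :: "('g, 'c, 'r) lang" where
  rall: "set \<Gamma> \<subseteq> types L \<Longrightarrow> \<sigma> \<in> types L \<Longrightarrow> wf_form L (\<sigma> # \<Gamma>) B \<Longrightarrow> wf_form L (\<sigma> # \<Gamma>) A \<Longrightarrow>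
    Alls \<Gamma> (Iff (RAll \<sigma> B A) (All \<sigma> (Imp B A))) \<in> restricted_axioms L"
| rex: "set \<Gamma> \<subseteq> types L \<Longrightarrow> \<sigma> \<in> types L \<Longrightarrow> wf_form L (\<sigma> # \<Gamma>) B \<Longrightarrow> wf_form L (\<sigma> # \<Gamma>) A \<Longrightarrow>
    Alls \<Gamma> (Iff (REx \<sigma> B A) (Ex \<sigma> (And B A))) \<in> restricted_axioms L"

definition HA_consts :: "'g ty set \<Rightarrow> ('g, 'c) const set" where
  "HA_consts Ts = {Zero, Succ, TT, FF}
     \<union> {CombK \<sigma> \<tau> | \<sigma> \<tau>. \<sigma> \<in> Ts \<and> \<tau> \<in> Ts}
     \<union> {CombS \<rho> \<sigma> \<tau> | \<rho> \<sigma> \<tau>. \<rho> \<in> Ts \<and> \<sigma> \<in> Ts \<and> \<tau> \<in> Ts}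
     \<union> Rec ` Ts \<union> Cond ` Ts"

text \<open>\<open>Ax\<close> is the set of axioms of an extension of \<open>HA\<^sup>\<omega>\<close> in the language \<open>L\<close>.\<close>

definition HA_extension :: "('g, 'c, 'r) lang \<Rightarrow> ('g, 'c, 'r) form set \<Rightarrow> bool" where
  "HA_extension L Ax \<longleftrightarrow>
     lang_ok L \<and> restricted L \<and>
     NatT \<in> types L \<and> BoolT \<in> types L \<and>
     (\<forall>\<sigma>\<in>types L. \<forall>\<tau>\<in>types L. \<sigma> \<rightarrow>\<^sub>t \<tau> \<in> types L) \<and>
     HA_consts (types L) \<subseteq> constants L \<and>
     rels L \<inter> range IPred = {} \<and>
     (\<forall>A\<in>Ax. wf_form L [] A) \<and>
     HA_axioms L \<union> restricted_axioms L \<subseteq> Ax"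

definition add_IPred :: "('g, 'c, 'r) lang \<Rightarrow> ('g, 'c, 'r) lang" where
  "add_IPred L = L\<lparr>rels := rels L \<union> IPred ` types L\<rparr>"

primrec relativize :: "('g, 'c, 'r) form \<Rightarrow> ('g, 'c, 'r) form" where
  "relativize Bot = Bot"
| "relativize (Eq \<sigma> s t) = Eq \<sigma> s t"
| "relativize (Rel R ts) = Rel R ts"
| "relativize (And A B) = And (relativize A) (relativize B)"
| "relativize (Imp A B) = Imp (relativize A) (relativize B)"
| "relativize (All \<sigma> A) = All \<sigma> (Imp (Rel (IPred \<sigma>) [Var 0]) (relativize A))"
| "relativize (Ex \<sigma> A) = Ex \<sigma> (And (Rel (IPred \<sigma>) [Var 0]) (relativize A))"
| "relativize (RAll \<sigma> B A) = All \<sigma> (Imp (relativize B) (relativize A))"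
| "relativize (REx \<sigma> B A) = Ex \<sigma> (And (relativize B) (relativize A))"

text \<open>\<open>\<I>(\<^bold>x)\<close> for the variables \<open>\<^bold>x\<close> of the context \<open>\<Gamma>\<close>.\<close>

definition I_context :: "'g ty list \<Rightarrow> ('g, 'c, 'r) form" where
  "I_context \<Gamma> = Conjs (map (\<lambda>i. Rel (IPred (\<Gamma> ! i)) [Var i]) [0..<length \<Gamma>])"


section \<open>The target theory\<close>

text \<open>Elementary facts about the types of non-empty finite subsets of the types in \<open>Ws\<close>.\<close>

inductive_set set_axioms :: "('g, 'c, 'r) lang \<Rightarrow> 'g ty set \<Rightarrow> ('g, 'c, 'r) form set"
  for L :: "('g, 'c, 'r) lang" and Ws :: "'g ty set" where
  sing: "\<sigma> \<in> Ws \<Longrightarrow>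
    All \<sigma> (All \<sigma> (Iff (Rel (Mem \<sigma>) [Var 1, Con (Sing \<sigma>) \<bullet> Var 0])
      (Eq \<sigma> (Var 1) (Var 0)))) \<in> set_axioms L Ws"
| union: "\<sigma> \<in> Ws \<Longrightarrow>
    All \<sigma> (All (Star \<sigma>) (All (Star \<sigma>)
      (Iff (Rel (Mem \<sigma>) [Var 2, Con (Union2 \<sigma>) \<bullet> Var 1 \<bullet> Var 0])
           (Or (Rel (Mem \<sigma>) [Var 2, Var 1]) (Rel (Mem \<sigma>) [Var 2, Var 0]))))) \<in> set_axioms L Ws"
| indexed_union: "\<rho> \<in> Ws \<Longrightarrow> \<sigma> \<in> Ws \<Longrightarrow>
    All \<sigma> (All (Star \<rho>) (All (\<rho> \<rightarrow>\<^sub>t Star \<sigma>)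
      (Iff (Rel (Mem \<sigma>) [Var 2, Con (UnionI \<rho> \<sigma>) \<bullet> Var 1 \<bullet> Var 0])
           (Ex \<rho> (And (Rel (Mem \<rho>) [Var 0, Var 2])
                      (Rel (Mem \<sigma>) [Var 3, Var 1 \<bullet> Var 0])))))) \<in> set_axioms L Ws"
| nonempty: "\<sigma> \<in> Ws \<Longrightarrow> All (Star \<sigma>) (Ex \<sigma> (Rel (Mem \<sigma>) [Var 0, Var 1])) \<in> set_axioms L Ws"
| extensionality: "\<sigma> \<in> Ws \<Longrightarrow>
    All (Star \<sigma>) (All (Star \<sigma>) (Imp
      (All \<sigma> (Iff (Rel (Mem \<sigma>) [Var 0, Var 2]) (Rel (Mem \<sigma>) [Var 0, Var 1])))
      (Eq (Star \<sigma>) (Var 1) (Var 0)))) \<in> set_axioms L Ws"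
| finite_induction: "set \<Gamma> \<subseteq> types L \<Longrightarrow> \<sigma> \<in> Ws \<Longrightarrow> wf_form L (Star \<sigma> # \<Gamma>) A \<Longrightarrow>
    Alls \<Gamma> (Imp (All \<sigma> (put 1 (Con (Sing \<sigma>) \<bullet> Var 0) A))
      (Imp (All (Star \<sigma>) (All (Star \<sigma>) (Imp (put 2 (Var 1) A) (Imp (put 2 (Var 0) A)
              (put 2 (Con (Union2 \<sigma>) \<bullet> Var 1 \<bullet> Var 0) A)))))
           (All (Star \<sigma>) A))) \<in> set_axioms L Ws"
| max_upper: "All (Star NatT) (All NatT (Imp (Rel (Mem NatT) [Var 0, Var 1])
      (Le (Var 0) (Con MaxN \<bullet> Var 1)))) \<in> set_axioms L Ws"
| max_mem: "All (Star NatT) (Rel (Mem NatT) [Con MaxN \<bullet> Var 0, Var 0]) \<in> set_axioms L Ws"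

text \<open>Intuitionistic natural deduction from the set \<open>T\<close> of sentences, in a context \<open>\<Gamma>\<close> of typed
  free variables and under a set \<open>H\<close> of hypotheses. Equality is governed by axioms; a classical
  theory is one that contains the law of excluded middle. No sort is assumed to be inhabited
  beyond what \<open>T\<close> and the closed terms provide.\<close>

inductive prov :: "('g, 'c, 'r) lang \<Rightarrow> ('g, 'c, 'r) form set \<Rightarrow> 'g ty list \<Rightarrow>
    ('g, 'c, 'r) form set \<Rightarrow> ('g, 'c, 'r) form \<Rightarrow> bool"
  for L :: "('g, 'c, 'r) lang" and T :: "('g, 'c, 'r) form set" where
  Axiom: "A \<in> T \<Longrightarrow> prov L T \<Gamma> H A"
| Hyp: "A \<in> H \<Longrightarrow> prov L T \<Gamma> H A"
| BotE: "prov L T \<Gamma> H Bot \<Longrightarrow> wf_form L \<Gamma> A \<Longrightarrow> prov L T \<Gamma> H A"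
| AndI: "prov L T \<Gamma> H A \<Longrightarrow> prov L T \<Gamma> H B \<Longrightarrow> prov L T \<Gamma> H (And A B)"
| AndE1: "prov L T \<Gamma> H (And A B) \<Longrightarrow> prov L T \<Gamma> H A"
| AndE2: "prov L T \<Gamma> H (And A B) \<Longrightarrow> prov L T \<Gamma> H B"
| ImpI: "wf_form L \<Gamma> A \<Longrightarrow> prov L T \<Gamma> (insert A H) B \<Longrightarrow> prov L T \<Gamma> H (Imp A B)"
| ImpE: "prov L T \<Gamma> H (Imp A B) \<Longrightarrow> prov L T \<Gamma> H A \<Longrightarrow> prov L T \<Gamma> H B"
| AllI: "\<sigma> \<in> types L \<Longrightarrow> prov L T (\<sigma> # \<Gamma>) (weaken 0 ` H) A \<Longrightarrow> prov L T \<Gamma> H (All \<sigma> A)"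
| AllE: "prov L T \<Gamma> H (All \<sigma> A) \<Longrightarrow> typing L \<Gamma> t \<sigma> \<Longrightarrow> prov L T \<Gamma> H (put 0 t A)"
| ExI: "\<sigma> \<in> types L \<Longrightarrow> wf_form L (\<sigma> # \<Gamma>) A \<Longrightarrow> typing L \<Gamma> t \<sigma> \<Longrightarrow>
    prov L T \<Gamma> H (put 0 t A) \<Longrightarrow> prov L T \<Gamma> H (Ex \<sigma> A)"
| ExE: "prov L T \<Gamma> H (Ex \<sigma> A) \<Longrightarrow> wf_form L \<Gamma> C \<Longrightarrow>
    prov L T (\<sigma> # \<Gamma>) (insert A (weaken 0 ` H)) (weaken 0 C) \<Longrightarrow> prov L T \<Gamma> H C"

definition witness_consts :: "'g ty set \<Rightarrow> ('g, 'c) const set" where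
  "witness_consts Ts = {Zero, Succ, MaxN}
     \<union> {CombK \<sigma> \<tau> | \<sigma> \<tau>. \<sigma> \<in> Ts \<and> \<tau> \<in> Ts}
     \<union> {CombS \<rho> \<sigma> \<tau> | \<rho> \<sigma> \<tau>. \<rho> \<in> Ts \<and> \<sigma> \<in> Ts \<and> \<tau> \<in> Ts}
     \<union> {UnionI \<rho> \<sigma> | \<rho> \<sigma>. \<rho> \<in> Ts \<and> \<sigma> \<in> Ts}
     \<union> Rec ` Ts \<union> Sing ` Ts \<union> Union2 ` Ts"

text \<open>The sublanguage of witnessing types and terms. Further ground types and constants are
  allowed, but every witnessing type must have a closed term.\<close>

definition witnessing_lang :: "('g, 'c, 'r) lang \<Rightarrow> bool" where
  "witnessing_lang W \<longleftrightarrow>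
     NatT \<in> types W \<and>
     (\<forall>\<sigma>\<in>types W. \<forall>\<tau>\<in>types W. \<sigma> \<rightarrow>\<^sub>t \<tau> \<in> types W) \<and>
     (\<forall>\<sigma>\<in>types W. Star \<sigma> \<in> types W) \<and>
     witness_consts (types W) \<subseteq> constants W \<and>
     (\<forall>c\<in>constants W. ctype c \<in> types W) \<and>
     rels W = Mem ` types W \<and>
     (\<forall>\<sigma>\<in>types W. \<exists>t. typing W [] t \<sigma>)"

text \<open>\<open>T\<close> is a theory in the target language \<open>L\<close>, for the source language \<open>LS\<close> and the
  witnessing sublanguage \<open>W\<close>.\<close>

definition target_theory :: "('g, 'c, 'r) lang \<Rightarrow> ('g, 'c, 'r) lang \<Rightarrow> ('g, 'c, 'r) lang \<Rightarrow>
    ('g, 'c, 'r) form set \<Rightarrow> bool" where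
  "target_theory LS W L T \<longleftrightarrow>
     lang_ok L \<and> \<not> restricted L \<and> witnessing_lang W \<and>
     types LS \<union> types W \<subseteq> types L \<and>
     constants LS \<union> constants W \<subseteq> constants L \<and>
     rels W \<subseteq> rels L \<and>
     (\<forall>A\<in>T. wf_form L [] A) \<and>
     (\<forall>A \<in> HA_axioms L \<union> set_axioms L (types W). prov L T [] {} A)"


section \<open>The interpretations\<close>

text \<open>\<open>\<langle>R(\<^bold>x)\<rangle>\<close> with witnesses \<open>\<^bold>c\<close>, \<open>\<^bold>d\<close> is the formula \<open>base_form R\<close> of the target language, whose
  variables are, in the order of their indices, \<open>\<^bold>x\<close>, \<open>\<^bold>c\<close>, \<open>\<^bold>d\<close>.\<close>

record ('g, 'c, 'r) base =
  base_pos :: "('g, 'r) rel \<Rightarrow> 'g ty list"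
  base_neg :: "('g, 'r) rel \<Rightarrow> 'g ty list"
  base_form :: "('g, 'r) rel \<Rightarrow> ('g, 'c, 'r) form"

definition base_interpretation :: "('g, 'c, 'r) lang \<Rightarrow> ('g, 'c, 'r) lang \<Rightarrow> ('g, 'c, 'r) lang \<Rightarrow>
    ('g, 'c, 'r) base \<Rightarrow> bool" where
  "base_interpretation LS W L bi \<longleftrightarrow>
     (\<forall>R \<in> rels (add_IPred LS).
        set (base_pos bi R) \<subseteq> types W \<and> set (base_neg bi R) \<subseteq> types W \<and>
        wf_form L (arity R @ base_pos bi R @ base_neg bi R) (base_form bi R))"

definition bounding_at_NatT :: "('g, 'c, 'r) base \<Rightarrow> bool" where
  "bounding_at_NatT bi \<longleftrightarrow>
     base_pos bi (IPred NatT) = [NatT] \<and> base_neg bi (IPred NatT) = [] \<and>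
     base_form bi (IPred NatT) = Le (Var 0) (Var 1)"

text \<open>A witness type is a pair of tuples: the types of the positive and of the negative witnesses.
  Restricted quantifiers do not occur in relativizations; here they are read as the formulas they
  are equivalent to.\<close>

type_synonym 'g wtype = "'g ty list \<times> 'g ty list"

fun and_type :: "'g wtype \<Rightarrow> 'g wtype \<Rightarrow> 'g wtype" where
  "and_type (\<alpha>, \<beta>) (\<gamma>, \<delta>) = (\<alpha> @ \<gamma>, \<beta> @ \<delta>)"

fun imp_type :: "'g wtype \<Rightarrow> 'g wtype \<Rightarrow> 'g wtype" where
  "imp_type (\<alpha>, \<beta>) (\<gamma>, \<delta>) = (map (Funs \<alpha>) \<gamma> @ map (\<lambda>\<tau>. Funs (\<alpha> @ \<delta>) (Star \<tau>)) \<beta>, \<alpha> @ \<delta>)"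

fun ex_type :: "'g wtype \<Rightarrow> 'g wtype" where
  "ex_type (\<alpha>, \<beta>) = (\<alpha>, map Star \<beta>)"

primrec witness_types :: "('g, 'c, 'r) base \<Rightarrow> ('g, 'c, 'r) form \<Rightarrow> 'g wtype" where
  "witness_types bi Bot = ([], [])"
| "witness_types bi (Eq \<sigma> s t) = ([], [])"
| "witness_types bi (Rel R ts) = (base_pos bi R, base_neg bi R)"
| "witness_types bi (And A B) = and_type (witness_types bi A) (witness_types bi B)"
| "witness_types bi (Imp A B) = imp_type (witness_types bi A) (witness_types bi B)"
| "witness_types bi (All \<sigma> A) = witness_types bi A"
| "witness_types bi (Ex \<sigma> A) = ex_type (witness_types bi A)"
| "witness_types bi (RAll \<sigma> B A) = imp_type (witness_types bi B) (witness_types bi A)"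
| "witness_types bi (REx \<sigma> B A) = ex_type (and_type (witness_types bi B) (witness_types bi A))"

abbreviation pos :: "('g, 'c, 'r) base \<Rightarrow> ('g, 'c, 'r) form \<Rightarrow> 'g ty list" where
  "pos bi A \<equiv> fst (witness_types bi A)"

abbreviation neg :: "('g, 'c, 'r) base \<Rightarrow> ('g, 'c, 'r) form \<Rightarrow> 'g ty list" where
  "neg bi A \<equiv> snd (witness_types bi A)"

text \<open>\<open>BAlls \<tau>s Bs A\<close> is \<open>\<forall>\<^bold>b\<in>\<^bold>B A\<close>: the terms \<open>Bs\<close> live outside of the quantifiers, and in \<open>A\<close> the
  variables \<open>\<^bold>b\<close> of types \<open>\<tau>s\<close> are the indices \<open>0, \<dots>, length \<tau>s - 1\<close>.\<close>

primrec BAlls :: "'g ty list \<Rightarrow> ('g, 'c) tm list \<Rightarrow> ('g, 'c, 'r) form \<Rightarrow> ('g, 'c, 'r) form" where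
  "BAlls [] Bs A = A"
| "BAlls (\<tau> # \<tau>s) Bs A =
     BAlls \<tau>s (tl Bs) (All \<tau> (Imp (Rel (Mem \<tau>) [Var 0, lift (Suc (length \<tau>s)) (hd Bs)]) A))"

abbreviation vars :: "nat \<Rightarrow> ('g, 'c) tm list" where
  "vars n \<equiv> map Var [0..<n]"

text \<open>An interpreted formula \<open>F\<close> is a function of an environment \<open>e\<close>, which maps the free variables
  of the formula to terms of the target language, and of the terms that serve as positive and as
  negative witnesses. The clauses for the connectives act on interpreted formulas and their witness
  types.\<close>

type_synonym ('g, 'c, 'r) iform =
  "(nat \<Rightarrow> ('g, 'c) tm) \<Rightarrow> ('g, 'c) tm list \<Rightarrow> ('g, 'c) tm list \<Rightarrow> ('g, 'c, 'r) form"

fun and_interp :: "'g wtype \<Rightarrow> ('g, 'c, 'r) iform \<Rightarrow> ('g, 'c, 'r) iform \<Rightarrow> ('g, 'c, 'r) iform" where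
  "and_interp (\<alpha>, \<beta>) F G e p q =
     (let a = take (length \<alpha>) p; c = drop (length \<alpha>) p;
          b = take (length \<beta>) q; d = drop (length \<beta>) q
      in And (F e a b) (G e c d))"

fun imp_interp :: "'g wtype \<Rightarrow> 'g wtype \<Rightarrow> ('g, 'c, 'r) iform \<Rightarrow> ('g, 'c, 'r) iform \<Rightarrow>
    ('g, 'c, 'r) iform" where
  "imp_interp (\<alpha>, \<beta>) (\<gamma>, \<delta>) F G e p q =
     (let f = take (length \<gamma>) p; g = drop (length \<gamma>) p;
          a = take (length \<alpha>) q; d = drop (length \<alpha>) q;
          n = length \<beta>
      in Imp (BAlls \<beta> (map (\<lambda>h. Apps h (a @ d)) g) (F (lift n \<circ> e) (map (lift n) a) (vars n)))
             (G e (map (\<lambda>h. Apps h a) f) d))"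

definition all_interp :: "'g ty \<Rightarrow> ('g, 'c, 'r) iform \<Rightarrow> ('g, 'c, 'r) iform" where
  "all_interp \<sigma> F e p q = All \<sigma> (F (up e) (map (lift 1) p) (map (lift 1) q))"

fun ex_interp :: "'g ty \<Rightarrow> 'g wtype \<Rightarrow> ('g, 'c, 'r) iform \<Rightarrow> ('g, 'c, 'r) iform" where
  "ex_interp \<sigma> (\<alpha>, \<beta>) F e p Q =
     (let n = length \<beta>
      in Ex \<sigma> (BAlls \<beta> (map (lift 1) Q) (F (lift n \<circ> up e) (map (lift (n + 1)) p) (vars n))))"

primrec interp :: "('g, 'c, 'r) base \<Rightarrow> ('g, 'c, 'r) form \<Rightarrow> ('g, 'c, 'r) iform" where
  "interp bi Bot = (\<lambda>e p q. Bot)"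
| "interp bi (Eq \<sigma> s t) = (\<lambda>e p q. Eq \<sigma> (tsub e s) (tsub e t))"
| "interp bi (Rel R ts) = (\<lambda>e p q. fsub (\<lambda>i. (map (tsub e) ts @ p @ q) ! i) (base_form bi R))"
| "interp bi (And A B) = and_interp (witness_types bi A) (interp bi A) (interp bi B)"
| "interp bi (Imp A B) =
     imp_interp (witness_types bi A) (witness_types bi B) (interp bi A) (interp bi B)"
| "interp bi (All \<sigma> A) = all_interp \<sigma> (interp bi A)"
| "interp bi (Ex \<sigma> A) = ex_interp \<sigma> (witness_types bi A) (interp bi A)"
| "interp bi (RAll \<sigma> B A) = all_interp \<sigma>
     (imp_interp (witness_types bi B) (witness_types bi A) (interp bi B) (interp bi A))"
| "interp bi (REx \<sigma> B A) = ex_interp \<sigma> (and_type (witness_types bi B) (witness_types bi A))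
     (and_interp (witness_types bi B) (interp bi B) (interp bi A))"

text \<open>\<open>\<Gamma>\<close> is the context of the free variables of \<open>A\<close>.\<close>

definition U_interpretable :: "('g, 'c, 'r) lang \<Rightarrow> ('g, 'c, 'r) lang \<Rightarrow> ('g, 'c, 'r) form set \<Rightarrow>
    ('g, 'c, 'r) base \<Rightarrow> 'g ty list \<Rightarrow> ('g, 'c, 'r) form \<Rightarrow> bool" where
  "U_interpretable W L T bi \<Gamma> A \<longleftrightarrow>
     (\<exists>ts. list_all2 (typing W []) ts (pos bi A) \<and>
        (let n = length (neg bi A)
         in prov L T \<Gamma> {} (Alls (neg bi A) (interp bi A (\<lambda>i. Var (i + n)) ts (vars n)))))"

definition I_interpretable :: "('g, 'c, 'r) lang \<Rightarrow> ('g, 'c, 'r) lang \<Rightarrow> ('g, 'c, 'r) form set \<Rightarrow>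
    ('g, 'c, 'r) base \<Rightarrow> 'g ty list \<Rightarrow> ('g, 'c, 'r) form \<Rightarrow> bool" where
  "I_interpretable W L T bi \<Gamma> A \<longleftrightarrow>
     U_interpretable W L T bi [] (Alls \<Gamma> (Imp (I_context \<Gamma>) (relativize A)))"

text \<open>In the following, \<open>B\<close> has the free variables \<open>x\<close>, with index 0 and type \<open>\<sigma>\<close>, and \<open>\<^bold>y\<close>, with
  context \<open>\<Gamma>\<close>.\<close>

definition subsumes_I :: "('g, 'c, 'r) lang \<Rightarrow> ('g, 'c, 'r) lang \<Rightarrow> ('g, 'c, 'r) form set \<Rightarrow>
    ('g, 'c, 'r) base \<Rightarrow> 'g ty \<Rightarrow> 'g ty list \<Rightarrow> ('g, 'c, 'r) form \<Rightarrow> bool" where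
  "subsumes_I W L T bi \<sigma> \<Gamma> B \<longleftrightarrow>
     U_interpretable W L T bi []
       (Alls \<Gamma> (Imp (I_context \<Gamma>) (All \<sigma> (Imp (relativize B) (Rel (IPred \<sigma>) [Var 0])))))"

definition semi_uniform :: "('g, 'c, 'r) lang \<Rightarrow> ('g, 'c, 'r) lang \<Rightarrow> ('g, 'c, 'r) form set \<Rightarrow>
    ('g, 'c, 'r) base \<Rightarrow> 'g ty \<Rightarrow> 'g ty list \<Rightarrow> ('g, 'c, 'r) form \<Rightarrow> bool" where
  "semi_uniform W L T bi \<sigma> \<Gamma> B \<longleftrightarrow>
     subsumes_I W L T bi \<sigma> \<Gamma> B \<and> pos bi (relativize B) = []"

end

theory Submission
  imports Defs
begin

text \<open>
  A positive witness of the premise consists of a bound \<open>m\<close>, witnesses \<open>\<^bold>c\<close> for \<open>C\<close> and functionals \<open>\<^bold>g\<close>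
  for \<open>B\<close>; because \<open>B\<close> has no positive witnesses, \<open>m\<close> does not depend on anything. The conclusion
  has positive witnesses of the same types, and with \<open>k = m\<close> its matrix, for the negative witnesses
  \<open>\<^bold>D\<close>, becomes \<open>m \<le> m\<close> together with literally the interpretation of the premise at \<open>\<^bold>D\<close>. So the
  principle is realized by projections: the given \<open>m, \<^bold>c, \<^bold>g\<close> are returned, and the set of negative
  witnesses of the conclusion is passed to the premise.
\<close>

section \<open>Substitution\<close>

text \<open>A single \<open>k\<close> serves all \<open>x\<close> for two reasons. The
  interpretation of \<open>All\<close> is uniform, so witnesses are chosen before \<open>x\<close>;
  and the witness of the \<open>I\<close>-predicate at \<open>NatT\<close> is an upper bound, not a
  value, so what the premise supplies for \<open>n\<close> already is the \<open>k\<close> that the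
  conclusion asks for. The obstacle is the status of equality. Realizers are combinator terms, and a
  projection applied to its arguments is only provably equal to the selected argument, while
  \<open>interp\<close> copies witness terms into formulas. The argument is therefore split: the
  implication is derived for the literal tuples \<open>a\<close> and \<open>D\<close>, where both
  sides agree syntactically, and is then carried over to the projections by Leibniz's law, applied
  to a formula with fresh variables in the places of the witnesses. This is why most of the
  development concerns substitution into interpreted formulas and their well-formedness.\<close>

lemma tsub_tsub: "tsub s (tsub t x) = tsub (tsub s \<circ> t) x"
  by (induction x) auto

lemma tsub_Var [simp]: "tsub Var x = x"
  by (induction x) auto

lemma lift_0 [simp]: "lift 0 t = t"
  by (simp add: lift_def)

lemma lift_lift [simp]: "lift m (lift n t) = lift (m + n) t"
  by (simp add: lift_def tsub_tsub o_def add_ac)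

lemma lift_Var [simp]: "lift n (Var i) = Var (i + n)"
  by (simp add: lift_def)

lemma lift_App [simp]: "lift n (s \<bullet> t) = lift n s \<bullet> lift n t"
  by (simp add: lift_def)

lemma up_0 [simp]: "up e 0 = Var 0"
  and up_Suc [simp]: "up e (Suc i) = lift 1 (e i)"
  by (simp_all add: up_def)

lemma up_Var [simp]: "up Var = Var"
  by (rule ext, case_tac x) auto

lemma tsub_lift: "tsub s (lift n t) = tsub (\<lambda>i. s (i + n)) t"
  by (simp add: lift_def tsub_tsub o_def)

lemma lift_tsub: "lift n (tsub e t) = tsub (\<lambda>i. lift n (e i)) t"
  by (simp add: lift_def tsub_tsub o_def)

lemma up_comp: "tsub (up s) \<circ> up t = up (tsub s \<circ> t)"
  by (rule ext, case_tac x) (auto simp: tsub_lift lift_tsub)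

lemma fsub_fsub: "fsub s (fsub t A) = fsub (tsub s \<circ> t) A"
  by (induction A arbitrary: s t) (auto simp: tsub_tsub up_comp)

lemma fsub_Var [simp]: "fsub Var A = A"
  by (induction A) (auto simp: map_idI)

text \<open>Closed form of a substitution carried under \<open>n\<close> binders; it lets a whole
  tuple of quantifiers be crossed at once.\<close>

lemma funpow_up: "(up ^^ n) s i = (if i < n then Var i else lift n (s (i - n)))"
proof (induction n arbitrary: i)
  case (Suc n)
  show ?case by (cases i) (auto simp: Suc)
qed simp

lemma tsub_funpow_up_lift [simp]: "tsub ((up ^^ n) s) (lift n t) = lift n (tsub s t)"
  by (simp add: tsub_lift funpow_up lift_tsub)

lemma tsub_Apps [simp]: "tsub s (Apps t ts) = Apps (tsub s t) (map (tsub s) ts)"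
  by (induction ts arbitrary: t) auto

lemma weaken_0: "weaken 0 = fsub (\<lambda>i. Var (Suc i))"
  by (simp add: weaken_def)

text \<open>Counterpart of \<open>put 0\<close> for a block of variables: the terms replace the
  block simultaneously and live outside it, so none is shifted past another, and the remaining
  indices drop by the length of the block.\<close>

definition inst :: "('g, 'c) tm list \<Rightarrow> nat \<Rightarrow> ('g, 'c) tm" where
  "inst ts i = (if i < length ts then ts ! i else Var (i - length ts))"

lemma inst_Nil [simp]: "inst [] = Var"
  by (auto simp: inst_def)

lemma inst_Cons: "inst (t # ts) = case_nat t (inst ts)"
  by (rule ext) (auto simp: inst_def split: nat.split)

lemma put_0: "put 0 t = fsub (case_nat t Var)"
  by (simp add: put_def)

text \<open>The bounds \<open>Bs\<close> live outside the quantifiers and receive \<open>s\<close>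
  itself; only the matrix sees \<open>s\<close> under the binders. The lift inside
  \<open>BAlls\<close> commutes with the substitution by \<open>tsub_funpow_up_lift\<close>.\<close>

lemma fsub_BAlls:
  "length Bs = length \<tau>s \<Longrightarrow>
   fsub s (BAlls \<tau>s Bs A) = BAlls \<tau>s (map (tsub s) Bs) (fsub ((up ^^ length \<tau>s) s) A)"
proof (induction \<tau>s arbitrary: Bs A)
  case (Cons \<tau> \<tau>s)
  then obtain b bs where Bs: "Bs = b # bs" "length bs = length \<tau>s" by (cases Bs) auto
  have "tsub (up ((up ^^ length \<tau>s) s)) (lift (Suc (length \<tau>s)) b) = lift (Suc (length \<tau>s)) (tsub s b)"
    using tsub_funpow_up_lift[of "Suc (length \<tau>s)" s b] by simp
  then show ?case by (simp add: Bs Cons.IH)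
qed simp


section \<open>Typing\<close>

definition subst_ok :: "('g, 'c, 'r) lang \<Rightarrow> 'g ty list \<Rightarrow> 'g ty list \<Rightarrow> (nat \<Rightarrow> ('g, 'c) tm) \<Rightarrow> bool"
  where "subst_ok L \<Gamma> \<Xi> e \<longleftrightarrow> (\<forall>i<length \<Gamma>. typing L \<Xi> (e i) (\<Gamma> ! i))"

lemmas typing_App = typing.intros(3)

lemma typing_Var: "i < length \<Gamma> \<Longrightarrow> \<Gamma> ! i = \<tau> \<Longrightarrow> typing L \<Gamma> (Var i) \<tau>"
  using typing.intros(1) by metis

lemma typing_Con: "c \<in> constants L \<Longrightarrow> ctype c = \<tau> \<Longrightarrow> typing L \<Gamma> (Con c) \<tau>"
  using typing.intros(2) by metis

lemma typing_mono: "typing L \<Gamma> t \<tau> \<Longrightarrow> constants L \<subseteq> constants L' \<Longrightarrow> typing L' \<Gamma> t \<tau>"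
  by (induction rule: typing.induct) (auto intro: typing.intros)

lemma typing_tsub: "typing L \<Gamma> t \<tau> \<Longrightarrow> subst_ok L \<Gamma> \<Xi> e \<Longrightarrow> typing L \<Xi> (tsub e t) \<tau>"
  by (induction rule: typing.induct) (auto intro: typing.intros simp: subst_ok_def)

lemma subst_ok_Var_append: "subst_ok L \<Gamma> (\<Gamma> @ \<Xi>) Var"
  by (auto simp: subst_ok_def nth_append intro!: typing_Var)

lemma typing_append: "typing L \<Gamma> t \<tau> \<Longrightarrow> typing L (\<Gamma> @ \<Xi>) t \<tau>"
  using typing_tsub[OF _ subst_ok_Var_append] by fastforce

lemma typing_lift: "typing L \<Xi> t \<tau> \<Longrightarrow> n = length \<Xi>' \<Longrightarrow> typing L (\<Xi>' @ \<Xi>) (lift n t) \<tau>"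
  unfolding lift_def
  by (erule typing_tsub) (auto simp: subst_ok_def nth_append intro: typing_Var)

lemma typing_lift1: "typing L \<Xi> t \<tau> \<Longrightarrow> typing L (\<sigma> # \<Xi>) (lift 1 t) \<tau>"
  using typing_lift[of L \<Xi> t \<tau> 1 "[\<sigma>]"] by simp

lemma typing_Apps:
  "typing L \<Gamma> t (Funs \<sigma>s \<tau>) \<Longrightarrow> list_all2 (typing L \<Gamma>) ts \<sigma>s \<Longrightarrow> typing L \<Gamma> (Apps t ts) \<tau>"
  by (induction \<sigma>s arbitrary: t ts) (fastforce simp: list_all2_Cons2 intro: typing.intros)+

lemma typing_vars: "list_all2 (typing L (\<Gamma> @ \<Xi>)) (vars (length \<Gamma>)) \<Gamma>"
  by (auto simp: list_all2_conv_all_nth nth_append intro!: typing_Var)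

lemma tsub_cong: "typing L \<Gamma> t \<tau> \<Longrightarrow> (\<And>i. i < length \<Gamma> \<Longrightarrow> s i = s' i) \<Longrightarrow> tsub s t = tsub s' t"
  by (induction rule: typing.induct) auto

lemma lift_closed: "typing L [] t \<tau> \<Longrightarrow> lift n t = t"
  using tsub_cong[of L "[]" t \<tau> _ Var] by (auto simp: lift_def)

lemma subst_ok_up: "subst_ok L \<Gamma> \<Xi> e \<Longrightarrow> subst_ok L (\<sigma> # \<Gamma>) (\<sigma> # \<Xi>) (up e)"
  unfolding subst_ok_def
proof safe
  fix i assume "\<forall>i<length \<Gamma>. typing L \<Xi> (e i) (\<Gamma> ! i)" "i < length (\<sigma> # \<Gamma>)"
  then show "typing L (\<sigma> # \<Xi>) (up e i) ((\<sigma> # \<Gamma>) ! i)"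
    by (cases i) (auto intro: typing_Var typing_lift1[simplified])
qed

lemma subst_ok_lift:
  "subst_ok L \<Gamma> \<Xi> e \<Longrightarrow> n = length \<Xi>' \<Longrightarrow> subst_ok L \<Gamma> (\<Xi>' @ \<Xi>) (lift n \<circ> e)"
  by (auto simp: subst_ok_def intro: typing_lift)

lemma wf_form_fsub: "wf_form L \<Gamma> A \<Longrightarrow> subst_ok L \<Gamma> \<Xi> e \<Longrightarrow> wf_form L \<Xi> (fsub e A)"
proof (induction A arbitrary: \<Gamma> \<Xi> e)
  case (Rel R ts)
  then show ?case by (auto intro: typing_tsub simp: list_all2_conv_all_nth)
next
  case (Eq \<sigma> s t)
  then show ?case by (auto intro: typing_tsub)
qed (simp; blast intro: subst_ok_up)+

lemma wf_form_append: "wf_form L \<Gamma> A \<Longrightarrow> wf_form L (\<Gamma> @ \<Xi>) A"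
  using wf_form_fsub[OF _ subst_ok_Var_append] by fastforce

text \<open>Formulas see only the indices of their context. This matters for environments given by
  \<open>nth\<close> of a list, whose values beyond the end are unspecified.\<close>

lemma fsub_cong:
  "wf_form L \<Gamma> A \<Longrightarrow> (\<And>i. i < length \<Gamma> \<Longrightarrow> s i = s' i) \<Longrightarrow> fsub s A = fsub s' A"
proof (induction A arbitrary: \<Gamma> s s')
  case (Eq \<sigma> t u)
  then show ?case by (auto intro: tsub_cong)
next
  case (Rel R ts)
  then show ?case
    by (fastforce simp: list_all2_conv_all_nth in_set_conv_nth intro: tsub_cong)
next
  case (And A B)
  show ?case using And.IH[of \<Gamma> s s'] And.prems by simp
next
  case (Imp A B)
  show ?case using Imp.IH[of \<Gamma> s s'] Imp.prems by simp
next
  case (All \<sigma> A)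
  have "fsub (up s) A = fsub (up s') A"
    by (rule All.IH[of "\<sigma> # \<Gamma>"]) (use All.prems in \<open>auto simp: up_def split: nat.split\<close>)
  then show ?case by simp
next
  case (Ex \<sigma> A)
  have "fsub (up s) A = fsub (up s') A"
    by (rule Ex.IH[of "\<sigma> # \<Gamma>"]) (use Ex.prems in \<open>auto simp: up_def split: nat.split\<close>)
  then show ?case by simp
next
  case (RAll \<sigma> A B)
  have "fsub (up s) A = fsub (up s') A" "fsub (up s) B = fsub (up s') B"
    by (rule RAll.IH[of "\<sigma> # \<Gamma>"]; use RAll.prems in \<open>auto simp: up_def split: nat.split\<close>)+
  then show ?case by simp
next
  case (REx \<sigma> A B)
  have "fsub (up s) A = fsub (up s') A" "fsub (up s) B = fsub (up s') B"
    by (rule REx.IH[of "\<sigma> # \<Gamma>"]; use REx.prems in \<open>auto simp: up_def split: nat.split\<close>)+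
  then show ?case by simp
qed simp

lemma subst_ok_inst: "list_all2 (typing L \<Xi>) ts \<Theta> \<Longrightarrow> subst_ok L (\<Theta> @ \<Xi>) \<Xi> (inst ts)"
  by (auto simp: subst_ok_def inst_def list_all2_conv_all_nth nth_append intro: typing_Var)


section \<open>Derived rules of the target theory\<close>

lemma prov_mono: "prov L T \<Gamma> H A \<Longrightarrow> H \<subseteq> H' \<Longrightarrow> prov L T \<Gamma> H' A"
proof (induction arbitrary: H' rule: prov.induct)
  case (ImpI \<Gamma> A H B)
  have "prov L T \<Gamma> (insert A H') B" by (rule ImpI.IH) (use ImpI.prems in auto)
  then show ?case using ImpI.hyps by (blast intro: prov.ImpI)
next
  case (AllI \<sigma> \<Gamma> H A)
  have "prov L T (\<sigma> # \<Gamma>) (weaken 0 ` H') A" by (rule AllI.IH) (use AllI.prems in auto)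
  then show ?case using AllI.hyps by (blast intro: prov.AllI)
next
  case (ExE \<Gamma> H \<sigma> A C)
  have "prov L T (\<sigma> # \<Gamma>) (insert A (weaken 0 ` H')) (weaken 0 C)"
    by (rule ExE.IH(2)) (use ExE.prems in auto)
  then show ?case using ExE.IH(1)[OF ExE.prems] ExE.hyps by (blast intro: prov.ExE)
qed (blast intro: prov.intros)+

text \<open>Types appended at the end of a context leave all existing indices alone, so this form of
  weakening changes neither the formula nor the hypotheses.\<close>

lemma prov_append: "prov L T \<Gamma> H A \<Longrightarrow> prov L T (\<Gamma> @ \<Xi>) H A"
proof (induction rule: prov.induct)
  case (ExI \<sigma> \<Gamma> A t H)
  then show ?case
    using wf_form_append[of L "\<sigma> # \<Gamma>" A \<Xi>] by (auto intro: prov.ExI typing_append)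
qed (auto intro: prov.intros typing_append wf_form_append)

text \<open>\<open>Alls\<close> makes the last type of the context the outermost quantifier, so the
  outer block \<open>\<Gamma>\<close> is eliminated with \<open>ts'\<close> before the innermost
  quantifier is eliminated with \<open>t\<close>.\<close>

lemma prov_Alls_inst:
  "prov L T \<Xi> H (Alls \<Gamma> A) \<Longrightarrow> list_all2 (typing L \<Xi>) ts \<Gamma> \<Longrightarrow> prov L T \<Xi> H (fsub (inst ts) A)"
proof (induction \<Gamma> arbitrary: A ts)
  case (Cons \<sigma> \<Gamma>)
  then obtain t ts' where ts: "ts = t # ts'" "typing L \<Xi> t \<sigma>" "list_all2 (typing L \<Xi>) ts' \<Gamma>"
    by (auto simp: list_all2_Cons2)
  have "prov L T \<Xi> H (fsub (inst ts') (All \<sigma> A))"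
    by (rule Cons.IH) (use Cons.prems ts in auto)
  then have "prov L T \<Xi> H (put 0 t (fsub (up (inst ts')) A))"
    using prov.AllE ts(2) by fastforce
  moreover have "tsub (case_nat t Var) \<circ> up (inst ts') = inst ts"
    by (rule ext) (auto simp: ts inst_Cons up_def tsub_lift split: nat.split)
  ultimately show ?case by (simp add: put_0 fsub_fsub)
qed simp

lemma prov_AllsI:
  "prov L T (\<Gamma> @ \<Xi>) {} A \<Longrightarrow> set \<Gamma> \<subseteq> types L \<Longrightarrow> prov L T \<Xi> {} (Alls \<Gamma> A)"
proof (induction \<Gamma> arbitrary: A)
  case (Cons \<sigma> \<Gamma>)
  then show ?case using prov.AllI[of \<sigma> L T "\<Gamma> @ \<Xi>" "{}" A] by simp
qed simp

text \<open>Moving under a binder weakens a universal hypothesis; instantiating it at the new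
  variable restores its body unchanged.\<close>

lemma fsub_weaken0_under:
  fixes A :: "('g, 'c, 'r) form"
  shows "put 0 (Var 0) (fsub (up (\<lambda>i. Var (Suc i))) A) = A"
proof -
  have "tsub (case_nat (Var 0) Var) \<circ> up (\<lambda>i. Var (Suc i)) = (Var :: nat \<Rightarrow> ('g, 'c) tm)"
    by (rule ext) (auto simp: up_def split: nat.split)
  then show ?thesis by (simp only: put_0 fsub_fsub fsub_Var)
qed

text \<open>Each step absorbs the innermost variable: the implication from \<open>A\<close> to
  \<open>A'\<close> yields the one between the two universal formulas, which are the matrices for
  the shorter tuple. Hence the generalization over \<open>A\<close>, \<open>A'\<close> and
  \<open>Bs\<close>.\<close>

lemma prov_Imp_BAlls:
  assumes "prov L T (\<tau>s @ \<Xi>) {} (Imp A A')" "wf_form L (\<tau>s @ \<Xi>) A"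
    and "list_all2 (typing L \<Xi>) Bs (map Star \<tau>s)" "set \<tau>s \<subseteq> types L" "Mem ` set \<tau>s \<subseteq> rels L"
  shows "prov L T \<Xi> {} (Imp (BAlls \<tau>s Bs A) (BAlls \<tau>s Bs A'))"
  using assms
proof (induction \<tau>s arbitrary: A A' Bs)
  case (Cons \<tau> \<tau>s)
  obtain b bs where Bs: "Bs = b # bs" "typing L \<Xi> b (Star \<tau>)"
      "list_all2 (typing L \<Xi>) bs (map Star \<tau>s)"
    using Cons.prems(3) by (auto simp: list_all2_Cons2)
  let ?M = "Rel (Mem \<tau>) [Var 0, lift (Suc (length \<tau>s)) b]"
  let ?F = "All \<tau> (Imp ?M A)"
  have M: "wf_form L (\<tau> # \<tau>s @ \<Xi>) ?M"
    using Cons.prems Bs typing_lift[of L \<Xi> b "Star \<tau>" "Suc (length \<tau>s)" "\<tau> # \<tau>s"]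
    by (auto intro!: typing_Var)
  let ?H = "insert ?M {weaken 0 ?F}"
  have "prov L T (\<tau> # \<tau>s @ \<Xi>) ?H (weaken 0 ?F)" by (rule prov.Hyp) simp
  then have "prov L T (\<tau> # \<tau>s @ \<Xi>) ?H (put 0 (Var 0) (fsub (up (\<lambda>i. Var (Suc i))) (Imp ?M A)))"
    unfolding weaken_0 fsub.simps(6) by (rule prov.AllE) (auto intro: typing_Var)
  then have "prov L T (\<tau> # \<tau>s @ \<Xi>) ?H (Imp ?M A)" by (simp only: fsub_weaken0_under)
  then have "prov L T (\<tau> # \<tau>s @ \<Xi>) ?H A"
    by (rule prov.ImpE) (auto intro: prov.Hyp)
  moreover have "prov L T (\<tau> # \<tau>s @ \<Xi>) ?H (Imp A A')"
    by (rule prov_mono[OF Cons.prems(1)[simplified]]) simp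
  ultimately have "prov L T (\<tau> # \<tau>s @ \<Xi>) ?H A'" by (blast intro: prov.ImpE)
  then have "prov L T (\<tau> # \<tau>s @ \<Xi>) {weaken 0 ?F} (Imp ?M A')"
    using M by (blast intro: prov.ImpI)
  then have "prov L T (\<tau>s @ \<Xi>) {?F} (All \<tau> (Imp ?M A'))"
    using Cons.prems(4) by (auto intro!: prov.AllI)
  moreover have "wf_form L (\<tau>s @ \<Xi>) ?F" using M Cons.prems by simp
  ultimately have "prov L T (\<tau>s @ \<Xi>) {} (Imp ?F (All \<tau> (Imp ?M A')))"
    by (blast intro: prov.ImpI)
  then show ?case
    using Cons.IH[of ?F "All \<tau> (Imp ?M A')" bs] Cons.prems(4,5) Bs M Cons.prems(2)
    by simp
qed simp

lemma wf_form_BAlls: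
  assumes "wf_form L (\<tau>s @ \<Xi>) A" "list_all2 (typing L \<Xi>) Bs (map Star \<tau>s)"
    and "set \<tau>s \<subseteq> types L" "Mem ` set \<tau>s \<subseteq> rels L"
  shows "wf_form L \<Xi> (BAlls \<tau>s Bs A)"
  using assms
proof (induction \<tau>s arbitrary: A Bs)
  case (Cons \<tau> \<tau>s)
  obtain b bs where Bs: "Bs = b # bs" "typing L \<Xi> b (Star \<tau>)"
      "list_all2 (typing L \<Xi>) bs (map Star \<tau>s)"
    using Cons.prems(2) by (auto simp: list_all2_Cons2)
  show ?case
    using Cons.prems Bs typing_lift[of L \<Xi> b "Star \<tau>" "Suc (length \<tau>s)" "\<tau> # \<tau>s"]
    by (auto intro!: Cons.IH typing_Var)
qed simp

section \<open>Provable equality in the target theory\<close>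

locale target =
  fixes LS W L :: "('g, 'c, 'r) lang" and T :: "('g, 'c, 'r) form set"
  assumes target: "target_theory LS W L T"
begin

lemma types_W: "types W \<subseteq> types L" and types_LS: "types LS \<subseteq> types L"
  and constants_W: "constants W \<subseteq> constants L" and constants_LS: "constants LS \<subseteq> constants L"
  and Mem_rels: "Mem ` types W \<subseteq> rels L"
  and NatT_W: "NatT \<in> types W"
  and Fun_W: "\<sigma> \<in> types W \<Longrightarrow> \<tau> \<in> types W \<Longrightarrow> \<sigma> \<rightarrow>\<^sub>t \<tau> \<in> types W"
  and Star_W: "\<sigma> \<in> types W \<Longrightarrow> Star \<sigma> \<in> types W"
  and closed_term_W: "\<sigma> \<in> types W \<Longrightarrow> \<exists>t. typing W [] t \<sigma>"
  and witness_consts: "witness_consts (types W) \<subseteq> constants W"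
  using target unfolding target_theory_def witnessing_lang_def by auto

lemma Funs_W: "set \<sigma>s \<subseteq> types W \<Longrightarrow> \<tau> \<in> types W \<Longrightarrow> Funs \<sigma>s \<tau> \<in> types W"
  by (induction \<sigma>s) (auto intro: Fun_W)

lemma prov_axiom:
  assumes "A \<in> HA_axioms L \<union> set_axioms L (types W)"
  shows "prov L T \<Xi> H A"
proof -
  have "prov L T [] {} A" using assms target unfolding target_theory_def by blast
  then have "prov L T ([] @ \<Xi>) {} A" by (rule prov_append)
  then show ?thesis using prov_mono[of L T \<Xi> "{}" A H] by simp
qed

lemma prov_eq_refl: "\<sigma> \<in> types L \<Longrightarrow> typing L \<Xi> t \<sigma> \<Longrightarrow> prov L T \<Xi> H (Eq \<sigma> t t)"
  using prov_Alls_inst[of L T \<Xi> H "[\<sigma>]" "Eq \<sigma> (Var 0) (Var 0)" "[t]"]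
    prov_axiom[of _ \<Xi> H] HA_axioms.eq_refl[of \<sigma> L]
  by (auto simp: inst_Cons)

lemma prov_eq_subst:
  assumes \<Xi>: "set \<Xi> \<subseteq> types L" and \<sigma>: "\<sigma> \<in> types L" and A: "wf_form L (\<sigma> # \<Xi>) A"
    and s: "typing L \<Xi> s \<sigma>" and t: "typing L \<Xi> t \<sigma>"
    and eq: "prov L T \<Xi> H (Eq \<sigma> s t)" and As: "prov L T \<Xi> H (put 0 s A)"
  shows "prov L T \<Xi> H (put 0 t A)"
proof -
  let ?E = "Imp (Eq \<sigma> (Var 1) (Var 0)) (Imp (put 2 (Var 1) A) (put 2 (Var 0) A))"
  \<comment> \<open>The scheme is closed over all of \<open>\<Xi>\<close>. Instantiating these
    parameters by \<open>vars (length \<Xi>)\<close> returns them to the same context, while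
    \<open>t\<close> and \<open>s\<close> fill indices 0 and 1.\<close>
  let ?ts = "t # s # vars (length \<Xi>)"
  have "prov L T \<Xi> H (Alls (\<sigma> # \<sigma> # \<Xi>) ?E)"
    using prov_axiom HA_axioms.eq_subst[OF \<Xi> \<sigma> A] by (metis Alls.simps(2) UnI1)
  then have *: "prov L T \<Xi> H (fsub (inst ?ts) ?E)"
    by (rule prov_Alls_inst) (use s t typing_vars[of L \<Xi> "[]"] in auto)
  have p: "fsub (inst ?ts) (put 2 r A) = put 0 (inst ?ts j) A" if "r = Var j" for r j
    unfolding put_def fsub_fsub
    by (rule fsub_cong[OF A]) (auto simp: inst_Cons inst_def that split: nat.split)
  have "fsub (inst ?ts) ?E = Imp (Eq \<sigma> s t) (Imp (put 0 s A) (put 0 t A))"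
    by (simp add: p[OF refl]) (simp add: inst_Cons)
  with * eq As show ?thesis by (metis prov.ImpE)
qed

lemma prov_eq_sym:
  assumes "set \<Xi> \<subseteq> types L" "\<sigma> \<in> types L" "typing L \<Xi> s \<sigma>" "typing L \<Xi> t \<sigma>"
    and "prov L T \<Xi> H (Eq \<sigma> s t)"
  shows "prov L T \<Xi> H (Eq \<sigma> t s)"
proof -
  have "wf_form L (\<sigma> # \<Xi>) (Eq \<sigma> (Var 0) (lift 1 s))"
    using assms typing_lift1[of L \<Xi> s \<sigma> \<sigma>] by (simp add: typing_Var)
  from prov_eq_subst[OF assms(1,2) this assms(3-5)] prov_eq_refl[OF assms(2,3)]
  show ?thesis by (simp add: put_0 tsub_lift)
qed

lemma prov_eq_trans:
  assumes "set \<Xi> \<subseteq> types L" "\<sigma> \<in> types L" "typing L \<Xi> s \<sigma>" "typing L \<Xi> t \<sigma>" "typing L \<Xi> u \<sigma>"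
    and "prov L T \<Xi> H (Eq \<sigma> s t)" "prov L T \<Xi> H (Eq \<sigma> t u)"
  shows "prov L T \<Xi> H (Eq \<sigma> s u)"
proof -
  have "wf_form L (\<sigma> # \<Xi>) (Eq \<sigma> (lift 1 s) (Var 0))"
    using assms typing_lift1[of L \<Xi> s \<sigma> \<sigma>] by (simp add: typing_Var)
  from prov_eq_subst[OF assms(1,2) this assms(4,5,7)] assms(6)
  show ?thesis by (simp add: put_0 tsub_lift)
qed

lemma prov_eq_App:
  assumes "set \<Xi> \<subseteq> types L" "\<sigma> \<rightarrow>\<^sub>t \<tau> \<in> types L" "\<tau> \<in> types L"
    and "typing L \<Xi> f (\<sigma> \<rightarrow>\<^sub>t \<tau>)" "typing L \<Xi> g (\<sigma> \<rightarrow>\<^sub>t \<tau>)" "typing L \<Xi> t \<sigma>"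
    and "prov L T \<Xi> H (Eq (\<sigma> \<rightarrow>\<^sub>t \<tau>) f g)"
  shows "prov L T \<Xi> H (Eq \<tau> (f \<bullet> t) (g \<bullet> t))"
proof -
  let ?A = "Eq \<tau> (lift 1 (f \<bullet> t)) (Var 0 \<bullet> lift 1 t)"
  have "typing L ((\<sigma> \<rightarrow>\<^sub>t \<tau>) # \<Xi>) (Var 0 \<bullet> lift 1 t) \<tau>"
    by (rule typing_App[OF typing_Var typing_lift1]) (use assms in auto)
  moreover have "typing L ((\<sigma> \<rightarrow>\<^sub>t \<tau>) # \<Xi>) (lift 1 (f \<bullet> t)) \<tau>"
    by (rule typing_lift1[OF typing_App]) (use assms in auto)
  ultimately have "wf_form L ((\<sigma> \<rightarrow>\<^sub>t \<tau>) # \<Xi>) ?A" using assms by simp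
  moreover have "prov L T \<Xi> H (Eq \<tau> (f \<bullet> t) (f \<bullet> t))"
    by (rule prov_eq_refl[OF _ typing_App]) (use assms in auto)
  ultimately show ?thesis
    using prov_eq_subst[of \<Xi> "\<sigma> \<rightarrow>\<^sub>t \<tau>" ?A f g H] assms by (simp add: put_0 tsub_lift)
qed

text \<open>Leibniz's law replaces one variable at a time. The hybrids \<open>mix k\<close>, which
  agree with \<open>t\<close> below \<open>k\<close> and with \<open>s\<close> from \<open>k\<close>
  on, lead from \<open>s\<close> to \<open>t\<close> in \<open>length \<Theta>\<close>
  steps.\<close>

lemma prov_fsub_cong:
  assumes \<Xi>: "set \<Xi> \<subseteq> types L" and \<Theta>: "set \<Theta> \<subseteq> types L" and A: "wf_form L \<Theta> A"
    and s: "subst_ok L \<Theta> \<Xi> s" and t: "subst_ok L \<Theta> \<Xi> t"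
    and eq: "\<And>i. i < length \<Theta> \<Longrightarrow> prov L T \<Xi> H (Eq (\<Theta> ! i) (s i) (t i))"
    and As: "prov L T \<Xi> H (fsub s A)"
  shows "prov L T \<Xi> H (fsub t A)"
proof -
  define mix where "mix k i = (if i < k then t i else s i)" for k i :: nat
  have "prov L T \<Xi> H (fsub (mix k) A)" if "k \<le> length \<Theta>" for k
    using that
  proof (induction k)
    case 0
    show ?case using As by (simp add: mix_def)
  next
    case (Suc k)
    let ?\<sigma> = "\<Theta> ! k"
    \<comment> \<open>The fresh index 0 holds position \<open>k\<close>, the only place where
      \<open>mix k\<close> and \<open>mix (Suc k)\<close> may differ; all other terms are lifted
      past it.\<close>
    let ?A = "fsub (\<lambda>i. if i = k then Var 0 else lift 1 (mix k i)) A"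
    have k: "k < length \<Theta>" using Suc.prems by simp
    have "wf_form L (?\<sigma> # \<Xi>) ?A"
      by (rule wf_form_fsub[OF A]) (use s t in
        \<open>auto simp: subst_ok_def mix_def intro: typing_Var typing_lift1[simplified]\<close>)
    moreover have put: "put 0 r ?A = fsub ((mix k)(k := r)) A" for r
      unfolding put_0 fsub_fsub
      by (rule arg_cong[where f = "\<lambda>e. fsub e A"]) (auto simp: tsub_lift fun_eq_iff)
    moreover have "(mix k)(k := s k) = mix k" "(mix k)(k := t k) = mix (Suc k)"
      by (auto simp: mix_def fun_eq_iff less_Suc_eq)
    ultimately show ?case
      using prov_eq_subst[of \<Xi> ?\<sigma> ?A "s k" "t k" H] Suc.IH k \<Xi> subsetD[OF \<Theta> nth_mem[OF k]] s t eq[OF k]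
      by (auto simp: subst_ok_def)
  qed
  from this[of "length \<Theta>"] have "prov L T \<Xi> H (fsub (mix (length \<Theta>)) A)" by simp
  moreover have "fsub (mix (length \<Theta>)) A = fsub t A"
    by (rule fsub_cong[OF A]) (simp add: mix_def)
  ultimately show ?thesis by simp
qed

lemma prov_inst_cong:
  assumes "set \<Xi> \<subseteq> types L" "set \<Theta> \<subseteq> types L" "wf_form L (\<Theta> @ \<Xi>) A"
    and ss: "list_all2 (typing L \<Xi>) ss \<Theta>" and ts: "list_all2 (typing L \<Xi>) ts \<Theta>"
    and "\<And>i. i < length \<Theta> \<Longrightarrow> prov L T \<Xi> H (Eq (\<Theta> ! i) (ss ! i) (ts ! i))"
    and "prov L T \<Xi> H (fsub (inst ss) A)"
  shows "prov L T \<Xi> H (fsub (inst ts) A)"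
proof (rule prov_fsub_cong[of \<Xi> "\<Theta> @ \<Xi>"])
  fix i assume "i < length (\<Theta> @ \<Xi>)"
  then show "prov L T \<Xi> H (Eq ((\<Theta> @ \<Xi>) ! i) (inst ss i) (inst ts i))"
    using assms list_all2_lengthD[OF ss] list_all2_lengthD[OF ts]
    by (auto simp: inst_def nth_append intro!: prov_eq_refl typing_Var dest!: nth_mem)
qed (use assms in \<open>auto intro: subst_ok_inst\<close>)

text \<open>The typing conditions are built in so that equations can be chained by transitivity. The
  condition on \<open>\<Xi>\<close> is there because the Leibniz scheme is closed over the whole
  context.\<close>

definition eqv :: "'g ty list \<Rightarrow> 'g ty \<Rightarrow> ('g, 'c) tm \<Rightarrow> ('g, 'c) tm \<Rightarrow> bool" where
  "eqv \<Xi> \<tau> s t \<longleftrightarrow> set \<Xi> \<subseteq> types L \<and> \<tau> \<in> types W \<and> typing L \<Xi> s \<tau> \<and> typing L \<Xi> t \<tau> \<and>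
     prov L T \<Xi> {} (Eq \<tau> s t)"

lemma eqv_sym: "eqv \<Xi> \<tau> s t \<Longrightarrow> eqv \<Xi> \<tau> t s"
  unfolding eqv_def using types_W by (auto intro: prov_eq_sym)

lemma eqv_trans [trans]: "eqv \<Xi> \<tau> s t \<Longrightarrow> eqv \<Xi> \<tau> t u \<Longrightarrow> eqv \<Xi> \<tau> s u"
  unfolding eqv_def using types_W by (auto intro: prov_eq_trans)

lemma eqv_App:
  "eqv \<Xi> (\<sigma> \<rightarrow>\<^sub>t \<tau>) f g \<Longrightarrow> \<tau> \<in> types W \<Longrightarrow> typing L \<Xi> t \<sigma> \<Longrightarrow> eqv \<Xi> \<tau> (f \<bullet> t) (g \<bullet> t)"
  unfolding eqv_def using types_W
    typing_App[of L \<Xi> f \<sigma> \<tau> t] typing_App[of L \<Xi> g \<sigma> \<tau> t] prov_eq_App[of \<Xi> \<sigma> \<tau> f g t "{}"]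
    target[unfolded target_theory_def lang_ok_def] by blast

lemma eqv_Apps:
  "eqv \<Xi> (Funs \<sigma>s \<tau>) f g \<Longrightarrow> set \<sigma>s \<subseteq> types W \<Longrightarrow> \<tau> \<in> types W \<Longrightarrow>
   list_all2 (typing L \<Xi>) ts \<sigma>s \<Longrightarrow> eqv \<Xi> \<tau> (Apps f ts) (Apps g ts)"
proof (induction \<sigma>s arbitrary: f g ts)
  case (Cons \<sigma> \<sigma>s)
  then obtain t ts' where ts: "ts = t # ts'" "typing L \<Xi> t \<sigma>" "list_all2 (typing L \<Xi>) ts' \<sigma>s"
    by (auto simp: list_all2_Cons2)
  have "eqv \<Xi> (Funs \<sigma>s \<tau>) (f \<bullet> t) (g \<bullet> t)"
    by (rule eqv_App) (use Cons.prems ts in \<open>auto intro: Funs_W\<close>)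
  then show ?case using Cons.IH Cons.prems ts by simp
qed simp

lemma CombK_W: "\<sigma> \<in> types W \<Longrightarrow> \<tau> \<in> types W \<Longrightarrow> CombK \<sigma> \<tau> \<in> constants W"
  and CombS_W: "\<rho> \<in> types W \<Longrightarrow> \<sigma> \<in> types W \<Longrightarrow> \<tau> \<in> types W \<Longrightarrow> CombS \<rho> \<sigma> \<tau> \<in> constants W"
  by (rule subsetD[OF witness_consts]; simp add: witness_consts_def)+

lemma eqv_CombK:
  assumes "set \<Xi> \<subseteq> types L" "\<sigma> \<in> types W" "\<tau> \<in> types W" "typing L \<Xi> s \<sigma>" "typing L \<Xi> t \<tau>"
  shows "eqv \<Xi> \<sigma> (Con (CombK \<sigma> \<tau>) \<bullet> s \<bullet> t) s"
proof -
  have K: "CombK \<sigma> \<tau> \<in> constants L" using CombK_W constants_W assms by blast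
  have "prov L T \<Xi> {} (Alls [\<tau>, \<sigma>] (Eq \<sigma> (Con (CombK \<sigma> \<tau>) \<bullet> Var 1 \<bullet> Var 0) (Var 1)))"
    using prov_axiom HA_axioms.combK[OF K] by simp
  then have "prov L T \<Xi> {} (fsub (inst [t, s]) (Eq \<sigma> (Con (CombK \<sigma> \<tau>) \<bullet> Var 1 \<bullet> Var 0) (Var 1)))"
    by (rule prov_Alls_inst) (use assms in simp)
  moreover have "typing L \<Xi> (Con (CombK \<sigma> \<tau>) \<bullet> s \<bullet> t) \<sigma>"
    by (rule typing_App[OF typing_App[OF typing_Con[OF K]]]) (use assms in auto)
  ultimately show ?thesis using assms by (simp add: inst_Cons eqv_def)
qed

lemma eqv_CombS:
  assumes "set \<Xi> \<subseteq> types L" "\<rho> \<in> types W" "\<sigma> \<in> types W" "\<tau> \<in> types W"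
    and "typing L \<Xi> r (\<rho> \<rightarrow>\<^sub>t \<sigma> \<rightarrow>\<^sub>t \<tau>)" "typing L \<Xi> s (\<rho> \<rightarrow>\<^sub>t \<sigma>)" "typing L \<Xi> t \<rho>"
  shows "eqv \<Xi> \<tau> (Con (CombS \<rho> \<sigma> \<tau>) \<bullet> r \<bullet> s \<bullet> t) (r \<bullet> t \<bullet> (s \<bullet> t))"
proof -
  have S: "CombS \<rho> \<sigma> \<tau> \<in> constants L" using CombS_W constants_W assms by blast
  let ?E = "Eq \<tau> (Con (CombS \<rho> \<sigma> \<tau>) \<bullet> Var 2 \<bullet> Var 1 \<bullet> Var 0) (Var 2 \<bullet> Var 0 \<bullet> (Var 1 \<bullet> Var 0))"
  have "prov L T \<Xi> {} (Alls [\<rho>, \<rho> \<rightarrow>\<^sub>t \<sigma>, \<rho> \<rightarrow>\<^sub>t \<sigma> \<rightarrow>\<^sub>t \<tau>] ?E)"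
    using prov_axiom HA_axioms.combS[OF S] by simp
  then have "prov L T \<Xi> {} (fsub (inst [t, s, r]) ?E)"
    by (rule prov_Alls_inst) (use assms in simp)
  moreover have "typing L \<Xi> (Con (CombS \<rho> \<sigma> \<tau>) \<bullet> r \<bullet> s \<bullet> t) \<tau>"
    by (rule typing_App[OF typing_App[OF typing_App[OF typing_Con[OF S]]]])
      (use assms in auto)
  moreover have "typing L \<Xi> (r \<bullet> t \<bullet> (s \<bullet> t)) \<tau>"
    by (rule typing_App[OF typing_App typing_App]) (use assms in auto)
  ultimately show ?thesis using assms by (simp add: inst_Cons eqv_def numeral_2_eq_2)
qed

end


section \<open>Projections\<close>

text \<open>The classical term S K K.\<close>

definition identity :: "'g ty \<Rightarrow> ('g, 'c) tm" where
  "identity \<tau> = Con (CombS \<tau> (\<tau> \<rightarrow>\<^sub>t \<tau>) \<tau>) \<bullet> Con (CombK \<tau> (\<tau> \<rightarrow>\<^sub>t \<tau>)) \<bullet> Con (CombK \<tau> \<tau>)"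

text \<open>The curried \<lambda>t xs. t, built as S (K K) c with c the term for
  \<open>\<sigma>s\<close>: a value t goes to K (c t), which discards one more argument.\<close>

primrec constantly :: "'g ty list \<Rightarrow> 'g ty \<Rightarrow> ('g, 'c) tm" where
  "constantly [] \<tau> = identity \<tau>"
| "constantly (\<sigma> # \<sigma>s) \<tau> = Con (CombS \<tau> (Funs \<sigma>s \<tau>) (\<sigma> \<rightarrow>\<^sub>t Funs \<sigma>s \<tau>)) \<bullet>
     (Con (CombK (Funs \<sigma>s \<tau> \<rightarrow>\<^sub>t \<sigma> \<rightarrow>\<^sub>t Funs \<sigma>s \<tau>) \<tau>) \<bullet> Con (CombK (Funs \<sigma>s \<tau>) \<sigma>)) \<bullet>
     constantly \<sigma>s \<tau>"

text \<open>Arguments before position \<open>i\<close> are discarded by K; the selected one is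
  handed to \<open>constantly\<close>, which discards the rest. The clause for the empty list is a
  default value for positions out of range.\<close>

fun proj :: "'g ty list \<Rightarrow> nat \<Rightarrow> ('g, 'c) tm" where
  "proj (\<sigma> # \<sigma>s) 0 = constantly \<sigma>s \<sigma>"
| "proj (\<sigma> # \<sigma>s) (Suc i) = Con (CombK (Funs \<sigma>s (\<sigma>s ! i)) \<sigma>) \<bullet> proj \<sigma>s i"
| "proj [] i = Var i"

context target
begin

lemma typing_identity: "\<tau> \<in> types W \<Longrightarrow> typing W \<Xi> (identity \<tau>) (\<tau> \<rightarrow>\<^sub>t \<tau>)"
  unfolding identity_def
  by (rule typing_App[OF typing_App[OF typing_Con[OF CombS_W] typing_Con[OF CombK_W]]
        typing_Con[OF CombK_W]]) (auto intro: Fun_W)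

lemma typing_constantly:
  "set \<sigma>s \<subseteq> types W \<Longrightarrow> \<tau> \<in> types W \<Longrightarrow> typing W \<Xi> (constantly \<sigma>s \<tau>) (\<tau> \<rightarrow>\<^sub>t Funs \<sigma>s \<tau>)"
proof (induction \<sigma>s)
  case (Cons \<sigma> \<sigma>s)
  then have "Funs \<sigma>s \<tau> \<in> types W" by (auto intro: Funs_W)
  with Cons show ?case
    by (auto intro!: typing_App[OF typing_App[OF typing_Con[OF CombS_W] typing_App]]
        typing_Con[OF CombK_W] intro: Fun_W)
qed (simp add: typing_identity)

lemma typing_proj:
  "set \<sigma>s \<subseteq> types W \<Longrightarrow> i < length \<sigma>s \<Longrightarrow> typing W \<Xi> (proj \<sigma>s i) (Funs \<sigma>s (\<sigma>s ! i))"
proof (induction \<sigma>s i rule: proj.induct)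
  case (2 \<sigma> \<sigma>s i)
  then have "\<sigma>s ! i \<in> types W" by auto
  then have "Funs \<sigma>s (\<sigma>s ! i) \<in> types W" using 2 by (auto intro: Funs_W)
  with 2 show ?case by (auto intro!: typing_App[OF typing_Con[OF CombK_W]])
qed (simp_all add: typing_constantly)

lemma eqv_identity:
  assumes "set \<Xi> \<subseteq> types L" "\<tau> \<in> types W" "typing L \<Xi> t \<tau>"
  shows "eqv \<Xi> \<tau> (identity \<tau> \<bullet> t) t"
proof -
  let ?K = "Con (CombK \<tau> (\<tau> \<rightarrow>\<^sub>t \<tau>))" and ?K' = "Con (CombK \<tau> \<tau>)"
  have K: "typing L \<Xi> ?K (\<tau> \<rightarrow>\<^sub>t (\<tau> \<rightarrow>\<^sub>t \<tau>) \<rightarrow>\<^sub>t \<tau>)" "typing L \<Xi> ?K' (\<tau> \<rightarrow>\<^sub>t \<tau> \<rightarrow>\<^sub>t \<tau>)"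
    using assms constants_W by (auto intro!: typing_Con CombK_W Fun_W)
  have "eqv \<Xi> \<tau> (identity \<tau> \<bullet> t) (?K \<bullet> t \<bullet> (?K' \<bullet> t))"
    unfolding identity_def by (rule eqv_CombS) (use assms K in \<open>auto intro: Fun_W\<close>)
  also have "eqv \<Xi> \<tau> (?K \<bullet> t \<bullet> (?K' \<bullet> t)) t"
    by (rule eqv_CombK[OF _ _ _ _ typing_App]) (use assms K in \<open>auto intro: Fun_W\<close>)
  finally show ?thesis .
qed

lemma eqv_constantly:
  assumes "set \<Xi> \<subseteq> types L" "set \<sigma>s \<subseteq> types W" "\<tau> \<in> types W" "typing L \<Xi> t \<tau>"
    and "list_all2 (typing L \<Xi>) ts \<sigma>s"
  shows "eqv \<Xi> \<tau> (Apps (constantly \<sigma>s \<tau> \<bullet> t) ts) t"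
  using assms
proof (induction \<sigma>s arbitrary: ts)
  case (Cons \<sigma> \<sigma>s)
  then obtain x xs where ts: "ts = x # xs" "typing L \<Xi> x \<sigma>" "list_all2 (typing L \<Xi>) xs \<sigma>s"
    by (auto simp: list_all2_Cons2)
  let ?\<rho> = "Funs \<sigma>s \<tau>" and ?c = "constantly \<sigma>s \<tau>"
  let ?K = "Con (CombK ?\<rho> \<sigma>)" and ?K' = "Con (CombK (?\<rho> \<rightarrow>\<^sub>t \<sigma> \<rightarrow>\<^sub>t ?\<rho>) \<tau>)"
  have W: "?\<rho> \<in> types W" "\<sigma> \<in> types W" "\<tau> \<in> types W" "set \<sigma>s \<subseteq> types W"
    using Cons.prems by (auto intro: Funs_W)
  then have W': "\<sigma> \<rightarrow>\<^sub>t ?\<rho> \<in> types W" "?\<rho> \<rightarrow>\<^sub>t \<sigma> \<rightarrow>\<^sub>t ?\<rho> \<in> types W" by (auto intro: Fun_W)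
  have c: "typing L \<Xi> ?c (\<tau> \<rightarrow>\<^sub>t ?\<rho>)"
    using typing_mono[OF typing_constantly constants_W] W by blast
  have K: "typing L \<Xi> ?K (?\<rho> \<rightarrow>\<^sub>t \<sigma> \<rightarrow>\<^sub>t ?\<rho>)"
    by (rule typing_Con) (use CombK_W W constants_W in auto)
  have K': "typing L \<Xi> ?K' ((?\<rho> \<rightarrow>\<^sub>t \<sigma> \<rightarrow>\<^sub>t ?\<rho>) \<rightarrow>\<^sub>t \<tau> \<rightarrow>\<^sub>t ?\<rho> \<rightarrow>\<^sub>t \<sigma> \<rightarrow>\<^sub>t ?\<rho>)"
    by (rule typing_Con) (use CombK_W W W' constants_W in auto)
  have ct: "typing L \<Xi> (?c \<bullet> t) ?\<rho>" by (rule typing_App[OF c Cons.prems(4)])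
  have "eqv \<Xi> (\<sigma> \<rightarrow>\<^sub>t ?\<rho>) (constantly (\<sigma> # \<sigma>s) \<tau> \<bullet> t) (?K' \<bullet> ?K \<bullet> t \<bullet> (?c \<bullet> t))"
    unfolding constantly.simps
    by (rule eqv_CombS[OF _ _ _ _ typing_App]) (use Cons.prems W W' c K K' in auto)
  also have "eqv \<Xi> (\<sigma> \<rightarrow>\<^sub>t ?\<rho>) \<dots> (?K \<bullet> (?c \<bullet> t))"
    by (rule eqv_App[OF eqv_CombK W'(1) ct]) (use Cons.prems W W' K in auto)
  finally have "eqv \<Xi> ?\<rho> (constantly (\<sigma> # \<sigma>s) \<tau> \<bullet> t \<bullet> x) (?K \<bullet> (?c \<bullet> t) \<bullet> x)"
    by (rule eqv_App) (use W ts in auto)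
  also have "eqv \<Xi> ?\<rho> \<dots> (?c \<bullet> t)"
    by (rule eqv_CombK) (use Cons.prems W ts ct in auto)
  finally have "eqv \<Xi> \<tau> (Apps (constantly (\<sigma> # \<sigma>s) \<tau> \<bullet> t \<bullet> x) xs) (Apps (?c \<bullet> t) xs)"
    by (rule eqv_Apps) (use W ts in auto)
  also have "eqv \<Xi> \<tau> \<dots> t" by (rule Cons.IH) (use Cons.prems W ts in auto)
  finally show ?case by (simp add: ts del: constantly.simps)
qed (simp add: eqv_identity)

lemma eqv_proj:
  assumes "set \<Xi> \<subseteq> types L" "set \<sigma>s \<subseteq> types W" "i < length \<sigma>s" "list_all2 (typing L \<Xi>) ts \<sigma>s"
  shows "eqv \<Xi> (\<sigma>s ! i) (Apps (proj \<sigma>s i) ts) (ts ! i)"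
  using assms
proof (induction \<sigma>s i arbitrary: ts rule: proj.induct)
  case (1 \<sigma> \<sigma>s)
  then show ?case by (auto simp: list_all2_Cons2 intro: eqv_constantly)
next
  case (2 \<sigma> \<sigma>s i)
  then obtain x xs where ts: "ts = x # xs" "typing L \<Xi> x \<sigma>" "list_all2 (typing L \<Xi>) xs \<sigma>s"
    by (auto simp: list_all2_Cons2)
  have W: "\<sigma> \<in> types W" "\<sigma>s ! i \<in> types W" "set \<sigma>s \<subseteq> types W" "i < length \<sigma>s"
    using 2 by auto
  have "eqv \<Xi> (Funs \<sigma>s (\<sigma>s ! i)) (proj (\<sigma> # \<sigma>s) (Suc i) \<bullet> x) (proj \<sigma>s i)"
    unfolding proj.simps
    by (rule eqv_CombK)
      (use 2 W ts typing_mono[OF typing_proj constants_W] in \<open>auto intro: Funs_W\<close>)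
  then have "eqv \<Xi> (\<sigma>s ! i) (Apps (proj (\<sigma> # \<sigma>s) (Suc i) \<bullet> x) xs) (Apps (proj \<sigma>s i) xs)"
    by (rule eqv_Apps) (use W ts in auto)
  also have "eqv \<Xi> (\<sigma>s ! i) \<dots> (xs ! i)" by (rule 2) (use 2 W ts in auto)
  finally show ?case by (simp add: ts del: proj.simps)
qed simp

end

section \<open>Interpreted formulas\<close>

lemma list_all2_take_drop:
  "list_all2 P xs (\<alpha> @ \<beta>) \<Longrightarrow>
   list_all2 P (take (length \<alpha>) xs) \<alpha> \<and> list_all2 P (drop (length \<alpha>) xs) \<beta>"
  by (auto simp: list_all2_append2)

lemma map_funpow_up: "map ((up ^^ n) s) [0..<n] = vars n"
  by (simp add: funpow_up)

lemma relativize_fsub: "relativize (fsub s A) = fsub s (relativize A)"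
  by (induction A arbitrary: s) auto

lemma witness_types_fsub [simp]: "witness_types bi (fsub s A) = witness_types bi A"
  by (induction A arbitrary: s) auto

lemma witness_types_Alls [simp]: "witness_types bi (Alls \<Gamma> A) = witness_types bi A"
  by (induction \<Gamma> arbitrary: A) auto

lemma up_tsub: "up (\<lambda>i. tsub s (t i)) = (\<lambda>i. tsub (up s) (up t i))"
  using up_comp[of s t] by (simp add: o_def)

text \<open>Substitution into a source formula is absorbed by the environment as a syntactic
  identity: environments compose under each binder, and the witness types, which determine how
  tuples are split, are invariant under substitution.\<close>

lemma interp_comp:
  "interp bi (fsub s A) e p q = interp bi A (tsub e \<circ> s) p q"
proof (induction A arbitrary: s e p q)
  case (And A B)
  then show ?case
    by (cases "witness_types bi A"; cases "witness_types bi B") (simp add: Let_def)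
next
  case (Imp A B)
  then show ?case
    by (cases "witness_types bi A"; cases "witness_types bi B")
      (simp add: Let_def o_def lift_tsub)
next
  case (All \<sigma> A)
  then show ?case by (simp add: all_interp_def o_def up_tsub)
next
  case (Ex \<sigma> A)
  then show ?case
    by (cases "witness_types bi A")
      (simp add: Let_def o_def lift_tsub up_tsub)
next
  case (RAll \<sigma> A B)
  then show ?case
    by (cases "witness_types bi A"; cases "witness_types bi B")
      (simp add: Let_def all_interp_def o_def lift_tsub up_tsub)
next
  case (REx \<sigma> A B)
  then show ?case
    by (cases "witness_types bi A"; cases "witness_types bi B")
      (simp add: Let_def o_def lift_tsub up_tsub)
qed (simp_all add: tsub_tsub o_def)

lemma lift_0_fun: "lift 0 = (\<lambda>t. t)"
  by auto

text \<open>\<open>All\<close> is interpreted uniformly and leaves the witness tuples as they are,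
  hence parameters only cause a shift.\<close>

lemma interp_Alls:
  "interp bi (Alls \<Gamma> A) e p q =
   Alls \<Gamma> (interp bi A ((up ^^ length \<Gamma>) e) (map (lift (length \<Gamma>)) p) (map (lift (length \<Gamma>)) q))"
  by (induction \<Gamma> arbitrary: A) (simp_all add: all_interp_def o_def lift_0_fun)

section \<open>Relativized formulas: their language, substitution and typing\<close>

definition rel_lang :: "('g, 'c, 'r) lang \<Rightarrow> ('g, 'c, 'r) lang" where
  "rel_lang LS = (add_IPred LS)\<lparr>restricted := False\<rparr>"

lemma rel_lang_simps [simp]:
  "types (rel_lang LS) = types LS" "constants (rel_lang LS) = constants LS"
  "rels (rel_lang LS) = rels LS \<union> IPred ` types LS" "restricted (rel_lang LS) = False"
  by (simp_all add: rel_lang_def add_IPred_def)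

lemma typing_rel_lang: "typing LS \<Gamma> t \<tau> \<Longrightarrow> typing (rel_lang LS) \<Gamma> t \<tau>"
  by (erule typing_mono) simp

text \<open>Relativizations contain no restricted quantifiers; in \<open>rel_lang\<close> the cases
  \<open>RAll\<close> and \<open>REx\<close> of later inductions on well-formed formulas are
  therefore contradictory.\<close>

lemma wf_form_relativize: "wf_form LS \<Gamma> A \<Longrightarrow> wf_form (rel_lang LS) \<Gamma> (relativize A)"
  by (induction A arbitrary: \<Gamma>)
    (auto intro: typing_rel_lang typing_Var elim!: list_all2_mono)

locale interpretation_into_target = target LS W L T
  for LS W L :: "('g, 'c, 'r) lang" and T :: "('g, 'c, 'r) form set" +
  fixes bi :: "('g, 'c, 'r) base"
  assumes base: "base_interpretation LS W L bi"
begin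

lemma base_pos_W: "R \<in> rels (rel_lang LS) \<Longrightarrow> set (base_pos bi R) \<subseteq> types W"
  and base_neg_W: "R \<in> rels (rel_lang LS) \<Longrightarrow> set (base_neg bi R) \<subseteq> types W"
  and wf_base_form: "R \<in> rels (rel_lang LS) \<Longrightarrow>
    wf_form L (arity R @ base_pos bi R @ base_neg bi R) (base_form bi R)"
  using base unfolding base_interpretation_def add_IPred_def by auto

lemma witness_types_W:
  "wf_form (rel_lang LS) \<Theta> A \<Longrightarrow> set (pos bi A) \<subseteq> types W \<and> set (neg bi A) \<subseteq> types W"
proof (induction A arbitrary: \<Theta>)
  case (Rel R ts)
  then show ?case using base_pos_W base_neg_W by auto
next
  case (And A B)
  then have "set (pos bi A) \<subseteq> types W \<and> set (neg bi A) \<subseteq> types W"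
    "set (pos bi B) \<subseteq> types W \<and> set (neg bi B) \<subseteq> types W" using wf_form.simps(4,5) by metis+
  then show ?case
    by (cases "witness_types bi A"; cases "witness_types bi B") auto
next
  case (Imp A B)
  then have "set (pos bi A) \<subseteq> types W \<and> set (neg bi A) \<subseteq> types W"
    "set (pos bi B) \<subseteq> types W \<and> set (neg bi B) \<subseteq> types W" using wf_form.simps(4,5) by metis+
  then show ?case
    by (cases "witness_types bi A"; cases "witness_types bi B")
      (auto intro!: Funs_W Star_W simp del: foldr_append)
next
  case (Ex \<sigma> A)
  then have "set (pos bi A) \<subseteq> types W \<and> set (neg bi A) \<subseteq> types W" by auto
  then show ?case by (cases "witness_types bi A") (auto intro: Star_W)
next
  case (All \<sigma> A)
  then show ?case by (metis wf_form.simps(6) witness_types.simps(6))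
qed auto

text \<open>Here the substitution acts on the target side. The lengths guarantee that
  \<open>take\<close> and \<open>drop\<close> split the tuples as the witness types prescribe; in
  the case \<open>Rel\<close>, well-formedness of the base formula keeps every index inside the list
  of terms.\<close>

lemma fsub_interp:
  "wf_form (rel_lang LS) \<Theta> A \<Longrightarrow> length p = length (pos bi A) \<Longrightarrow> length q = length (neg bi A) \<Longrightarrow>
   fsub s (interp bi A e p q) = interp bi A (tsub s \<circ> e) (map (tsub s) p) (map (tsub s) q)"
proof (induction A arbitrary: \<Theta> s e p q)
  case (Eq \<sigma> t u)
  then show ?case by (simp add: tsub_tsub o_def)
next
  case (Rel R ts)
  have len: "length ts = length (arity R)" using Rel.prems(1) by (auto dest: list_all2_lengthD)
  have "wf_form L (arity R @ base_pos bi R @ base_neg bi R) (base_form bi R)"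
    using Rel.prems by (auto intro!: wf_base_form)
  then show ?case
    unfolding interp.simps fsub_fsub
  proof (rule fsub_cong)
    fix i assume "i < length (arity R @ base_pos bi R @ base_neg bi R)"
    then show "(tsub s \<circ> (\<lambda>i. (map (tsub e) ts @ p @ q) ! i)) i =
        (map (tsub (tsub s \<circ> e)) ts @ map (tsub s) p @ map (tsub s) q) ! i"
      using len Rel.prems by (auto simp: nth_append tsub_tsub)
  qed
next
  case (And A B)
  obtain \<alpha> \<beta> \<gamma> \<delta> where w: "witness_types bi A = (\<alpha>, \<beta>)" "witness_types bi B = (\<gamma>, \<delta>)"
    by fastforce
  show ?case using And.prems And.IH[of \<Theta>] by (simp add: w Let_def take_map drop_map)
next
  case (Imp A B)
  obtain \<alpha> \<beta> \<gamma> \<delta> where w: "witness_types bi A = (\<alpha>, \<beta>)" "witness_types bi B = (\<gamma>, \<delta>)"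
    by fastforce
  show ?case using Imp.prems Imp.IH[of \<Theta>]
    by (simp add: w Let_def take_map drop_map fsub_BAlls o_def map_funpow_up)
next
  case (All \<sigma> A)
  have "map (tsub (up s)) (map (lift 1) r) = map (lift 1) (map (tsub s) r)" for r
    using tsub_funpow_up_lift[of 1 s] by simp
  then show ?case using All.prems All.IH[of "\<sigma> # \<Theta>"]
    by (simp add: all_interp_def o_def up_tsub del: map_map)
next
  case (Ex \<sigma> A)
  obtain \<alpha> \<beta> where w: "witness_types bi A = (\<alpha>, \<beta>)" by fastforce
  have "tsub (up s) (lift (Suc 0) t) = lift (Suc 0) (tsub s t)"
    "tsub ((up ^^ n) (up s)) (lift (Suc n) t) = lift (Suc n) (tsub s t)" for n t
    using tsub_funpow_up_lift[of 1 s t] tsub_funpow_up_lift[of "Suc n" s t]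
    by (simp_all add: funpow_swap1)
  then show ?case using Ex.prems Ex.IH[of "\<sigma> # \<Theta>"]
    by (simp add: w Let_def fsub_BAlls o_def up_tsub map_funpow_up)
qed auto

text \<open>The rules \<open>ImpI\<close> and \<open>ExI\<close> and the Leibniz scheme demand
  well-formed formulas; this supplies them for interpreted ones.\<close>

lemma wf_form_interp:
  "wf_form (rel_lang LS) \<Theta> A \<Longrightarrow> subst_ok L \<Theta> \<Xi> e \<Longrightarrow>
   list_all2 (typing L \<Xi>) p (pos bi A) \<Longrightarrow> list_all2 (typing L \<Xi>) q (neg bi A) \<Longrightarrow>
   wf_form L \<Xi> (interp bi A e p q)"
proof (induction A arbitrary: \<Theta> \<Xi> e p q)
  case (Eq \<sigma> t u)
  then show ?case
    using types_LS constants_LS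
    by (auto intro!: typing_tsub[OF typing_mono])
next
  case (Rel R ts)
  have ts: "list_all2 (typing L \<Theta>) ts (arity R)"
    using Rel.prems(1) constants_LS typing_mono[of "rel_lang LS" \<Theta> _ _ L]
    by (auto elim!: list_all2_mono)
  have "list_all2 (typing L \<Xi>) (map (tsub e) ts @ p @ q) (arity R @ base_pos bi R @ base_neg bi R)"
    using Rel.prems ts
    by (auto simp: list_all2_map1 intro!: list_all2_appendI typing_tsub elim!: list_all2_mono)
  then have "subst_ok L (arity R @ base_pos bi R @ base_neg bi R) \<Xi>
      (\<lambda>i. (map (tsub e) ts @ p @ q) ! i)"
    unfolding subst_ok_def list_all2_conv_all_nth by simp
  then show ?case
    using Rel.prems by (auto intro!: wf_form_fsub[OF wf_base_form])
next
  case (And A B)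
  obtain \<alpha> \<beta> \<gamma> \<delta> where w: "witness_types bi A = (\<alpha>, \<beta>)" "witness_types bi B = (\<gamma>, \<delta>)"
    by fastforce
  have pq: "list_all2 (typing L \<Xi>) p (\<alpha> @ \<gamma>)" "list_all2 (typing L \<Xi>) q (\<beta> @ \<delta>)"
    using And.prems by (auto simp: w)
  show ?case
    using And.prems And.IH[of \<Theta> \<Xi> e] list_all2_take_drop[OF pq(1)] list_all2_take_drop[OF pq(2)]
    by (simp add: w Let_def)
next
  case (Imp A B)
  obtain \<alpha> \<beta> \<gamma> \<delta> where w: "witness_types bi A = (\<alpha>, \<beta>)" "witness_types bi B = (\<gamma>, \<delta>)"
    by fastforce
  let ?F = "map (Funs \<alpha>) \<gamma>" and ?G = "map (\<lambda>\<tau>. Funs (\<alpha> @ \<delta>) (Star \<tau>)) \<beta>"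
  have "list_all2 (typing L \<Xi>) p (?F @ ?G)" and q: "list_all2 (typing L \<Xi>) q (\<alpha> @ \<delta>)"
    using Imp.prems by (auto simp: w)
  from list_all2_take_drop[OF this(1)] have
    f: "list_all2 (typing L \<Xi>) (take (length \<gamma>) p) ?F" and
    g: "list_all2 (typing L \<Xi>) (drop (length \<gamma>) p) ?G" by auto
  from list_all2_take_drop[OF q] have
    a: "list_all2 (typing L \<Xi>) (take (length \<alpha>) q) \<alpha>" and
    d: "list_all2 (typing L \<Xi>) (drop (length \<alpha>) q) \<delta>" by auto
  have f': "list_all2 (typing L \<Xi>) (map (\<lambda>h. Apps h (take (length \<alpha>) q)) (take (length \<gamma>) p)) \<gamma>"
    using f typing_Apps[OF _ a]
    by (auto simp: list_all2_map1 list_all2_map2 elim!: list_all2_mono)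
  have "list_all2 (typing L \<Xi>)
      (map (\<lambda>h. Apps h (take (length \<alpha>) q @ drop (length \<alpha>) q)) (drop (length \<gamma>) p)) (map Star \<beta>)"
    using g typing_Apps[OF _ q]
    by (auto simp: list_all2_map1 list_all2_map2 elim!: list_all2_mono)
  moreover have "set \<beta> \<subseteq> types W" using witness_types_W[of \<Theta> A] Imp.prems by (auto simp: w)
  moreover have "wf_form L (\<beta> @ \<Xi>) (interp bi A (lift (length \<beta>) \<circ> e)
      (map (lift (length \<beta>)) (take (length \<alpha>) q)) (vars (length \<beta>)))"
  proof (rule Imp.IH(1)[of \<Theta>])
    show "subst_ok L \<Theta> (\<beta> @ \<Xi>) (lift (length \<beta>) \<circ> e)"
      using Imp.prems by (auto intro: subst_ok_lift)
    show "list_all2 (typing L (\<beta> @ \<Xi>)) (map (lift (length \<beta>)) (take (length \<alpha>) q)) (pos bi A)"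
      using a typing_lift[of L \<Xi> _ _ "length \<beta>" "\<beta>"]
      by (auto simp: w list_all2_map1 elim!: list_all2_mono)
  qed (use Imp.prems typing_vars[of L \<beta> \<Xi>] in \<open>auto simp: w\<close>)
  moreover have "wf_form L \<Xi> (interp bi B e
      (map (\<lambda>h. Apps h (take (length \<alpha>) q)) (take (length \<gamma>) p)) (drop (length \<alpha>) q))"
    by (rule Imp.IH(2)[of \<Theta>]) (use Imp.prems f' d in \<open>auto simp: w\<close>)
  ultimately show ?case
    using types_W Mem_rels by (auto simp: w Let_def simp del: foldl_append intro!: wf_form_BAlls)
next
  case (All \<sigma> A)
  have "wf_form L (\<sigma> # \<Xi>) (interp bi A (up e) (map (lift 1) p) (map (lift 1) q))"
    by (rule All.IH[of "\<sigma> # \<Theta>"])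
      (use All.prems in \<open>auto simp: list_all2_map1 intro!: subst_ok_up typing_lift1[simplified]
        elim!: list_all2_mono\<close>)
  then show ?case using All.prems types_LS by (auto simp: all_interp_def)
next
  case (Ex \<sigma> A)
  obtain \<alpha> \<beta> where w: "witness_types bi A = (\<alpha>, \<beta>)" by fastforce
  have "wf_form L (\<beta> @ \<sigma> # \<Xi>) (interp bi A (lift (length \<beta>) \<circ> up e)
      (map (lift (length \<beta> + 1)) p) (vars (length \<beta>)))"
  proof (rule Ex.IH[of "\<sigma> # \<Theta>"])
    show "subst_ok L (\<sigma> # \<Theta>) (\<beta> @ \<sigma> # \<Xi>) (lift (length \<beta>) \<circ> up e)"
      using Ex.prems by (auto intro: subst_ok_lift subst_ok_up)
    show "list_all2 (typing L (\<beta> @ \<sigma> # \<Xi>)) (map (lift (length \<beta> + 1)) p) (pos bi A)"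
      using Ex.prems(3) typing_lift[of L \<Xi> _ _ "length \<beta> + 1" "\<beta> @ [\<sigma>]"]
      by (auto simp: w list_all2_map1 elim!: list_all2_mono)
  qed (use Ex.prems typing_vars[of L \<beta> "\<sigma> # \<Xi>"] in \<open>auto simp: w\<close>)
  moreover have "set \<beta> \<subseteq> types W" using witness_types_W[of "\<sigma> # \<Theta>" A] Ex.prems by (auto simp: w)
  moreover have "list_all2 (typing L (\<sigma> # \<Xi>)) (map (lift 1) q) (map Star \<beta>)"
    using Ex.prems(4) by (auto simp: w list_all2_map1 intro: typing_lift1[simplified] elim!: list_all2_mono)
  ultimately show ?case
    using types_W Mem_rels types_LS Ex.prems by (auto simp: w Let_def intro!: wf_form_BAlls)
qed auto

end

section \<open>Replacing witnesses by provably equal ones\<close>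

context interpretation_into_target
begin

text \<open>Both implications are instances of one formula with variables in the places of the
  witnesses \<open>f\<close> and the bounds \<open>g\<close>, so that \<open>prov_inst_cong\<close>
  applies; \<open>X\<close>, \<open>D\<close> and \<open>e\<close> stay fixed.\<close>

lemma prov_Imp_cong:
  assumes \<Xi>: "set \<Xi> \<subseteq> types L"
    and X: "wf_form L (\<nu> @ \<Xi>) X" and \<nu>: "set \<nu> \<subseteq> types W"
    and Q: "wf_form (rel_lang LS) \<Theta> Q" and e: "subst_ok L \<Theta> \<Xi> e"
    and D: "list_all2 (typing L \<Xi>) D (neg bi Q)"
    and f: "length f = length (pos bi Q)" "length f' = length (pos bi Q)"
      "\<And>i. i < length (pos bi Q) \<Longrightarrow> eqv \<Xi> (pos bi Q ! i) (f ! i) (f' ! i)"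
    and g: "length g = length \<nu>" "length g' = length \<nu>"
      "\<And>i. i < length \<nu> \<Longrightarrow> eqv \<Xi> (Star (\<nu> ! i)) (g ! i) (g' ! i)"
    and prov: "prov L T \<Xi> {} (Imp (BAlls \<nu> g X) (interp bi Q e f D))"
  shows "prov L T \<Xi> {} (Imp (BAlls \<nu> g' X) (interp bi Q e f' D))"
proof -
  let ?\<pi> = "pos bi Q" and ?k = "length (pos bi Q)" and ?n = "length \<nu>"
  let ?m = "?k + ?n"
  let ?\<Psi> = "?\<pi> @ map Star \<nu>"
  \<comment> \<open>Indices below \<open>?k\<close> stand for the witnesses of \<open>Q\<close>, the
    next \<open>?n\<close> for the bounds. Everything fixed is shifted by \<open>?m\<close>, in
    \<open>X\<close> underneath its \<open>?n\<close> quantified variables.\<close>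
  let ?A = "Imp (BAlls \<nu> (map Var [?k..<?m]) (fsub ((up ^^ ?n) (\<lambda>i. Var (i + ?m))) X))
    (interp bi Q (lift ?m \<circ> e) (vars ?k) (map (lift ?m) D))"
  have inst: "fsub (inst (u @ v)) ?A = Imp (BAlls \<nu> v X) (interp bi Q e u D)"
    if u: "length u = ?k" and v: "length v = ?n" for u v
  proof -
    \<comment> \<open>The shift by \<open>?m\<close> and the instantiation of \<open>?m\<close>
      variables cancel, also underneath the quantifiers of \<open>BAlls\<close>.\<close>
    have "tsub ((up ^^ n) s) \<circ> (up ^^ n) t = (up ^^ n) (tsub s \<circ> t)" for n and s t :: "nat \<Rightarrow> ('g, 'c) tm"
      by (rule ext) (simp add: funpow_up)
    moreover have shift: "tsub (inst (u @ v)) \<circ> (\<lambda>i. Var (i + ?m)) = Var"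
      using u v by (auto simp: inst_def fun_eq_iff)
    moreover have "(up ^^ n) Var = (Var :: nat \<Rightarrow> ('g, 'c) tm)" for n by (induction n) auto
    ultimately have "fsub ((up ^^ ?n) (inst (u @ v))) (fsub ((up ^^ ?n) (\<lambda>i. Var (i + ?m))) X) = X"
      by (simp only: fsub_fsub fsub_Var)
    moreover have l: "tsub (inst (u @ v)) (lift ?m t) = t" for t
      using shift by (simp only: lift_def tsub_tsub tsub_Var)
    have "map (tsub (inst (u @ v))) (map Var [?k..<?m]) = v"
      "map (tsub (inst (u @ v))) (vars ?k) = u"
      using u v by (auto intro!: nth_equalityI simp: inst_def nth_append)
    moreover have "tsub (inst (u @ v)) \<circ> (lift ?m \<circ> e) = e" "map (tsub (inst (u @ v))) (map (lift ?m) D) = D"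
      using l by (auto simp: fun_eq_iff intro: map_idI)
    moreover have "fsub (inst (u @ v)) (interp bi Q (lift ?m \<circ> e) (vars ?k) (map (lift ?m) D)) =
        interp bi Q (tsub (inst (u @ v)) \<circ> (lift ?m \<circ> e)) (map (tsub (inst (u @ v))) (vars ?k))
          (map (tsub (inst (u @ v))) (map (lift ?m) D))"
      by (rule fsub_interp[OF Q]) (use D in \<open>auto dest: list_all2_lengthD\<close>)
    moreover have "fsub (inst (u @ v)) (BAlls \<nu> (map Var [?k..<?m]) (fsub ((up ^^ ?n) (\<lambda>i. Var (i + ?m))) X)) =
       BAlls \<nu> (map (tsub (inst (u @ v))) (map Var [?k..<?m]))
         (fsub ((up ^^ ?n) (inst (u @ v))) (fsub ((up ^^ ?n) (\<lambda>i. Var (i + ?m))) X))"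
      by (rule fsub_BAlls) simp
    ultimately show ?thesis by (simp only: fsub.simps)
  qed
  have \<pi>W: "set ?\<pi> \<subseteq> types W" using witness_types_W[OF Q] by simp
  have m: "?m = length ?\<Psi>" by simp
  have "wf_form L (\<nu> @ ?\<Psi> @ \<Xi>) (fsub ((up ^^ ?n) (\<lambda>i. Var (i + ?m))) X)"
    by (rule wf_form_fsub[OF X])
      (auto simp: subst_ok_def funpow_up nth_append intro!: typing_Var)
  then have "wf_form L (?\<Psi> @ \<Xi>)
      (BAlls \<nu> (map Var [?k..<?m]) (fsub ((up ^^ ?n) (\<lambda>i. Var (i + ?m))) X))"
    using \<nu> types_W Mem_rels
    by (intro wf_form_BAlls)
      (auto simp: list_all2_conv_all_nth nth_append intro!: typing_Var)
  moreover have "wf_form L (?\<Psi> @ \<Xi>) (interp bi Q (lift ?m \<circ> e) (vars ?k) (map (lift ?m) D))"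
  proof (rule wf_form_interp[OF Q])
    show "subst_ok L \<Theta> (?\<Psi> @ \<Xi>) (lift ?m \<circ> e)" by (rule subst_ok_lift[OF e m])
    show "list_all2 (typing L (?\<Psi> @ \<Xi>)) (vars ?k) ?\<pi>"
      using typing_vars[of L ?\<pi> "map Star \<nu> @ \<Xi>"] by simp
    show "list_all2 (typing L (?\<Psi> @ \<Xi>)) (map (lift ?m) D) (neg bi Q)"
      using D typing_lift[OF _ m] by (auto simp: list_all2_map1 elim!: list_all2_mono)
  qed
  ultimately have A: "wf_form L (?\<Psi> @ \<Xi>) ?A" by simp
  have "prov L T \<Xi> {} (fsub (inst (f' @ g')) ?A)"
  proof (rule prov_inst_cong[OF \<Xi> _ A])
    show "set ?\<Psi> \<subseteq> types L" using \<pi>W \<nu> types_W Star_W by auto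
    have eq: "eqv \<Xi> (?\<Psi> ! i) ((f @ g) ! i) ((f' @ g') ! i)" if "i < length ?\<Psi>" for i
      using that f g by (auto simp: nth_append)
    then show "list_all2 (typing L \<Xi>) (f @ g) ?\<Psi>" "list_all2 (typing L \<Xi>) (f' @ g') ?\<Psi>"
      using f(1,2) g(1,2) by (auto simp: list_all2_conv_all_nth eqv_def simp del: map_append)
    show "prov L T \<Xi> {} (Eq (?\<Psi> ! i) ((f @ g) ! i) ((f' @ g') ! i))" if "i < length ?\<Psi>" for i
      using eq[OF that] by (simp add: eqv_def)
    show "prov L T \<Xi> {} (fsub (inst (f @ g)) ?A)"
      using prov inst f(1) g(1) by simp
  qed
  then show ?thesis using inst f(2) g(2) by simp
qed

end


section \<open>The bounded collection principle\<close>

definition premise :: "'g ty \<Rightarrow> ('g, 'c, 'r) form \<Rightarrow> ('g, 'c, 'r) form \<Rightarrow> ('g, 'c, 'r) form" where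
  "premise \<sigma> B C = All \<sigma> (Imp B (Ex NatT (And (Rel (IPred NatT) [Var 0]) C)))"

text \<open>\<open>B\<close> and \<open>C\<close> stand for formulas already relativized. In the
  innermost context \<open>n\<close>, \<open>x\<close>, \<open>k\<close> have the indices 0, 1, 2,
  which explains \<open>Var 2\<close> and the two weakenings. Relativizing the bounded quantifier
  adds no \<open>I\<close>-predicate for \<open>n\<close>: in the conclusion it is \<open>k\<close>
  that carries the bound.\<close>

definition bounded :: "'g ty \<Rightarrow> ('g, 'c, 'r) form \<Rightarrow> ('g, 'c, 'r) form \<Rightarrow> ('g, 'c, 'r) form" where
  "bounded \<sigma> B C =
     All \<sigma> (Imp (weaken 1 B) (Ex NatT (And (Le (Var 0) (Var 2)) (weaken 2 C))))"

definition conclusion :: "'g ty \<Rightarrow> ('g, 'c, 'r) form \<Rightarrow> ('g, 'c, 'r) form \<Rightarrow> ('g, 'c, 'r) form" where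
  "conclusion \<sigma> B C = Ex NatT (And (Rel (IPred NatT) [Var 0]) (bounded \<sigma> B C))"

lemma relativize_collection:
  "relativize (Imp (RAll \<sigma> B (Ex NatT C))
      (Ex NatT (RAll \<sigma> (weaken 1 B) (REx NatT (Le (Var 0) (Var 2)) (weaken 2 C))))) =
    Imp (premise \<sigma> (relativize B) (relativize C)) (conclusion \<sigma> (relativize B) (relativize C))"
  by (simp add: premise_def conclusion_def bounded_def weaken_def relativize_fsub Le_def)

lemma tsub_monus [simp]: "tsub s (monus n k) = monus (tsub s n) (tsub s k)"
  by (simp add: monus_def predecessor_def)

lemma fsub_Le [simp]: "fsub s (Le n k) = Le (tsub s n) (tsub s k)"
  by (simp add: Le_def)

lemma interp_Le [simp]: "interp bi (Le n k) e p q = Le (tsub e n) (tsub e k)"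
  and witness_types_Le [simp]: "witness_types bi (Le n k) = ([], [])"
  by (simp_all add: Le_def)

text \<open>\<open>Ts\<close> is a parameter because the constants of arithmetic are given relative
  to the source types; the target language inherits them from the source.\<close>

lemma wf_form_Le:
  assumes "HA_consts Ts \<subseteq> constants L" "NatT \<in> Ts" "NatT \<rightarrow>\<^sub>t NatT \<in> Ts" "NatT \<in> types L"
    and "typing L \<Xi> n NatT" "typing L \<Xi> k NatT"
  shows "wf_form L \<Xi> (Le n k)"
proof -
  have c: "Rec NatT \<in> constants L" "Zero \<in> constants L" "CombK NatT NatT \<in> constants L"
    "CombK (NatT \<rightarrow>\<^sub>t NatT) NatT \<in> constants L"
    by (rule subsetD[OF assms(1)]; use assms(2,3) in \<open>simp add: HA_consts_def\<close>)+
  have Rec: "typing L \<Xi> (Con (Rec NatT)) (NatT \<rightarrow>\<^sub>t (NatT \<rightarrow>\<^sub>t NatT \<rightarrow>\<^sub>t NatT) \<rightarrow>\<^sub>t NatT \<rightarrow>\<^sub>t NatT)"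
    and Zero: "typing L \<Xi> (Con Zero) NatT"
    by (rule typing_Con; use c in simp)+
  have "typing L \<Xi> predecessor (NatT \<rightarrow>\<^sub>t NatT)"
    unfolding predecessor_def
    by (rule typing_App[OF typing_App[OF Rec Zero] typing_Con]) (use c in auto)
  then have "typing L \<Xi> (Con (CombK (NatT \<rightarrow>\<^sub>t NatT) NatT) \<bullet> predecessor) (NatT \<rightarrow>\<^sub>t NatT \<rightarrow>\<^sub>t NatT)"
    by (intro typing_App[OF typing_Con]) (use c in auto)
  then have "typing L \<Xi> (monus n k) NatT"
    unfolding monus_def using assms by (intro typing_App[OF typing_App[OF typing_App[OF Rec]]])
  then show ?thesis using Zero assms by (simp add: Le_def)
qed

section \<open>Interpretation of the premise and of the conclusion\<close>

locale bounding_interpretation = interpretation_into_target LS W L T bi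
  for LS W L :: "('g, 'c, 'r) lang" and T bi +
  fixes S :: "('g, 'c, 'r) form set"
  assumes HA: "HA_extension LS S" and bounding: "bounding_at_NatT bi"
begin

lemma NatT_LS: "NatT \<in> types LS" and NatT_L: "NatT \<in> types L"
  using HA types_LS unfolding HA_extension_def by auto

lemma wf_form_Le_L: "typing L \<Xi> n NatT \<Longrightarrow> typing L \<Xi> k NatT \<Longrightarrow> wf_form L \<Xi> (Le n k)"
  and wf_form_Le_rel_lang: "typing (rel_lang LS) \<Xi> n NatT \<Longrightarrow> typing (rel_lang LS) \<Xi> k NatT \<Longrightarrow>
    wf_form (rel_lang LS) \<Xi> (Le n k)"
  by (rule wf_form_Le[where Ts = "types LS"];
      use HA constants_LS types_LS in \<open>auto simp: HA_extension_def\<close>)+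

text \<open>Reflexivity needs no induction: \<open>m \<in> {m}\<close> is below \<open>max {m}\<close>, which lies in \<open>{m}\<close>.\<close>

lemma prov_Le_refl:
  assumes \<Xi>: "set \<Xi> \<subseteq> types L" and m: "typing L \<Xi> m NatT"
  shows "prov L T \<Xi> {} (Le m m)"
proof -
  let ?s = "Con (Sing NatT) \<bullet> m"
  let ?x = "Con MaxN \<bullet> ?s"
  have "Sing NatT \<in> constants L" "MaxN \<in> constants L"
    by (rule subsetD[OF constants_W], rule subsetD[OF witness_consts],
        simp add: witness_consts_def NatT_W)+
  then have s: "typing L \<Xi> ?s (Star NatT)" and x: "typing L \<Xi> ?x NatT"
    using m by (auto intro!: typing_App[OF typing_Con])
  have sing: "prov L T \<Xi> {} (Iff (Rel (Mem NatT) [y, ?s]) (Eq NatT y m))" if y: "typing L \<Xi> y NatT" for y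
  proof -
    have "prov L T \<Xi> {} (Alls [NatT, NatT]
        (Iff (Rel (Mem NatT) [Var 1, Con (Sing NatT) \<bullet> Var 0]) (Eq NatT (Var 1) (Var 0))))"
      using prov_axiom[OF UnI2, OF set_axioms.sing[OF NatT_W]] by simp
    from prov_Alls_inst[OF this, of "[m, y]"] m y show ?thesis by (simp add: inst_Cons Iff_def)
  qed
  have "prov L T \<Xi> {} (Rel (Mem NatT) [m, ?s])"
    using sing[OF m] prov_eq_refl[OF NatT_L m] unfolding Iff_def
    by (blast intro: prov.AndE2 prov.ImpE)
  moreover have "prov L T \<Xi> {} (Imp (Rel (Mem NatT) [m, ?s]) (Le m ?x))"
  proof -
    have "prov L T \<Xi> {} (Alls [NatT, Star NatT]
        (Imp (Rel (Mem NatT) [Var 0, Var 1]) (Le (Var 0) (Con MaxN \<bullet> Var 1))))"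
      using prov_axiom[OF UnI2, OF set_axioms.max_upper] by simp
    from prov_Alls_inst[OF this, of "[m, ?s]"] m s show ?thesis by (simp add: inst_Cons)
  qed
  ultimately have le: "prov L T \<Xi> {} (Le m ?x)" by (blast intro: prov.ImpE)
  have "prov L T \<Xi> {} (Rel (Mem NatT) [?x, ?s])"
  proof -
    have "prov L T \<Xi> {} (Alls [Star NatT] (Rel (Mem NatT) [Con MaxN \<bullet> Var 0, Var 0]))"
      using prov_axiom[OF UnI2, OF set_axioms.max_mem] by simp
    from prov_Alls_inst[OF this, of "[?s]"] s show ?thesis by (simp add: inst_Cons)
  qed
  then have eq: "prov L T \<Xi> {} (Eq NatT ?x m)"
    using sing[OF x] unfolding Iff_def by (blast intro: prov.AndE1 prov.ImpE)
  have "wf_form L (NatT # \<Xi>) (Le (lift 1 m) (Var 0))"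
    by (rule wf_form_Le_L) (use m typing_lift1 in \<open>auto intro: typing_Var\<close>)
  from prov_eq_subst[OF \<Xi> NatT_L this x m eq] le show ?thesis by (simp add: put_0 tsub_lift)
qed

lemma base_NatT:
  "base_pos bi (IPred NatT) = [NatT]" "base_neg bi (IPred NatT) = []"
  "base_form bi (IPred NatT) = Le (Var 0) (Var 1)"
  using bounding unfolding bounding_at_NatT_def by auto

text \<open>\<open>imp_type\<close> turns the positive witnesses of the consequent into functionals
  of those of the antecedent. With the empty tuple \<open>Funs []\<close> is the identity, so the
  bound keeps the type \<open>NatT\<close> and heads the tuple.\<close>

lemma witness_types_bounded:
  assumes "pos bi B = []"
  shows "pos bi (premise \<sigma> B C) = NatT # pos bi (bounded \<sigma> B C)"
    and "neg bi (premise \<sigma> B C) = neg bi (bounded \<sigma> B C)"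
  using assms
  by (cases "witness_types bi B"; cases "witness_types bi C";
      simp add: premise_def bounded_def base_NatT weaken_def)+

text \<open>Since \<open>B\<close> has no positive witnesses, the bound on \<open>n\<close> does not depend on them, and bounding
  \<open>n\<close> by the witness \<open>m\<close> is the same formula as bounding it by \<open>k\<close> with \<open>k = m\<close>.\<close>

lemma interp_bounded:
  assumes "pos bi B = []"
  shows "interp bi (bounded \<sigma> B C) (case_nat m e) p q = interp bi (premise \<sigma> B C) e (m # p) q"
proof -
  obtain \<beta> \<gamma> \<delta> where w: "witness_types bi B = ([], \<beta>)" "witness_types bi C = (\<gamma>, \<delta>)"
    using assms by (metis prod.collapse)
  \<comment> \<open>The weakenings skip the index of \<open>k\<close>, where \<open>case_nat\<close>
    inserts \<open>m\<close>; under one or two further binders that index is 1 or 2.\<close>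
  have "(\<lambda>i. up (case_nat m e) (if i < 1 then i else Suc i)) = up e"
    "(\<lambda>i. up (up (case_nat m e)) (if i < 2 then i else Suc i)) = up (up e)"
    by (auto simp: fun_eq_iff up_def split: nat.split)
  then have
    "(\<lambda>i. lift n (up (case_nat m e) (if i < 1 then i else Suc i))) = (\<lambda>i. lift n (up e i))"
    "(\<lambda>i. lift n (up (up (case_nat m e)) (if i < 2 then i else Suc i))) = (\<lambda>i. lift n (up (up e) i))" for n
    by metis+
  then show ?thesis
    by (simp add: bounded_def premise_def all_interp_def w base_NatT Let_def weaken_def interp_comp o_def
        numeral_2_eq_2)
qed

lemma wf_form_premise:
  "\<sigma> \<in> types LS \<Longrightarrow> wf_form (rel_lang LS) (\<sigma> # \<Theta>) B \<Longrightarrow> wf_form (rel_lang LS) (NatT # \<sigma> # \<Theta>) C \<Longrightarrow>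
   wf_form (rel_lang LS) \<Theta> (premise \<sigma> B C)"
  using NatT_LS by (auto simp: premise_def intro: typing_Var)

lemma wf_form_bounded:
  assumes "\<sigma> \<in> types LS" "wf_form (rel_lang LS) (\<sigma> # \<Theta>) B" "wf_form (rel_lang LS) (NatT # \<sigma> # \<Theta>) C"
  shows "wf_form (rel_lang LS) (NatT # \<Theta>) (bounded \<sigma> B C)"
proof -
  have "wf_form (rel_lang LS) (\<sigma> # NatT # \<Theta>) (weaken 1 B)"
    unfolding weaken_def by (rule wf_form_fsub[OF assms(2)])
      (auto simp: subst_ok_def nth_Cons split: nat.splits intro!: typing_Var)
  moreover have "wf_form (rel_lang LS) (NatT # \<sigma> # NatT # \<Theta>) (weaken 2 C)"
    unfolding weaken_def by (rule wf_form_fsub[OF assms(3)])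
      (auto simp: subst_ok_def nth_Cons split: nat.splits intro!: typing_Var)
  ultimately show ?thesis
    using assms NatT_LS by (auto simp: bounded_def intro!: wf_form_Le_rel_lang typing_Var)
qed

lemma wf_form_conclusion:
  "\<sigma> \<in> types LS \<Longrightarrow> wf_form (rel_lang LS) (\<sigma> # \<Theta>) B \<Longrightarrow> wf_form (rel_lang LS) (NatT # \<sigma> # \<Theta>) C \<Longrightarrow>
   wf_form (rel_lang LS) \<Theta> (conclusion \<sigma> B C)"
  using NatT_LS wf_form_bounded by (auto simp: conclusion_def intro: typing_Var)

text \<open>The \<open>I\<close>-predicate for \<open>k\<close> restores the \<open>NatT\<close>
  that \<open>bounded\<close> lacks, and the outer existential quantifier collects the negative
  witnesses into finite sets.\<close>

lemma witness_types_conclusion: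
  assumes "pos bi B = []"
  shows "pos bi (conclusion \<sigma> B C) = pos bi (premise \<sigma> B C)"
    and "neg bi (conclusion \<sigma> B C) = map Star (neg bi (premise \<sigma> B C))"
  using witness_types_bounded[OF assms]
  by (cases "witness_types bi (bounded \<sigma> B C)"; simp add: conclusion_def base_NatT)+

text \<open>The case of ideal realizers, which return \<open>a\<close> and \<open>D\<close>
  literally; the projections come in later. The term for \<open>k\<close> is \<open>m\<close>, the
  head of \<open>a\<close>.\<close>

lemma prov_premise_conclusion:
  fixes e :: "nat \<Rightarrow> ('g, 'c) tm" and B C :: "('g, 'c, 'r) form" and \<sigma> :: "'g ty"
  defines "\<nu> \<equiv> neg bi (premise \<sigma> B C)"
  assumes \<Xi>: "set \<Xi> \<subseteq> types L" and e: "subst_ok L \<Theta> \<Xi> e" and \<sigma>: "\<sigma> \<in> types LS"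
    and B: "wf_form (rel_lang LS) (\<sigma> # \<Theta>) B" and C: "wf_form (rel_lang LS) (NatT # \<sigma> # \<Theta>) C"
    and semi: "pos bi B = []"
    and a: "list_all2 (typing L \<Xi>) a (pos bi (premise \<sigma> B C))"
    and D: "list_all2 (typing L \<Xi>) D (map Star \<nu>)"
  shows "prov L T \<Xi> {} (Imp
    (BAlls \<nu> D (interp bi (premise \<sigma> B C) (lift (length \<nu>) \<circ> e) (map (lift (length \<nu>)) a) (vars (length \<nu>))))
    (interp bi (conclusion \<sigma> B C) e a D))"
proof -
  let ?n = "length \<nu>" and ?P = "premise \<sigma> B C"
  let ?A = "And (Rel (IPred NatT) [Var 0]) (bounded \<sigma> B C)"
  let ?X = "interp bi ?P (lift ?n \<circ> e) (map (lift ?n) a) (vars ?n)"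
  let ?Y = "BAlls \<nu> (map (lift 1) D) (interp bi ?A (lift ?n \<circ> up e) (map (lift (?n + 1)) a) (vars ?n))"
  obtain m a' where am: "a = m # a'" and m: "typing L \<Xi> m NatT"
    using a witness_types_bounded(1)[OF semi, of \<sigma> C] by (auto simp: list_all2_Cons2)
  have \<nu>W: "set \<nu> \<subseteq> types W"
    using witness_types_W[OF wf_form_premise[OF \<sigma> B C]] by (simp add: \<nu>_def)
  have A: "wf_form (rel_lang LS) (NatT # \<Theta>) ?A"
    using wf_form_bounded[OF \<sigma> B C] NatT_LS by (auto intro: typing_Var)
  have wA: "pos bi ?A = pos bi ?P" "neg bi ?A = \<nu>"
    using witness_types_bounded[OF semi, of \<sigma> C]
    by (cases "witness_types bi (bounded \<sigma> B C)"; simp add: base_NatT \<nu>_def)+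
  have Y: "interp bi (conclusion \<sigma> B C) e a D = Ex NatT ?Y"
    using wA by (cases "witness_types bi ?A") (simp add: conclusion_def Let_def)
  have X: "wf_form L (\<nu> @ \<Xi>) ?X"
  proof (rule wf_form_interp[OF wf_form_premise[OF \<sigma> B C]])
    show "subst_ok L \<Theta> (\<nu> @ \<Xi>) (lift ?n \<circ> e)" using e by (rule subst_ok_lift) simp
    show "list_all2 (typing L (\<nu> @ \<Xi>)) (map (lift ?n) a) (pos bi ?P)"
      using a typing_lift[of L \<Xi> _ _ ?n \<nu>] by (auto simp: list_all2_map1 elim!: list_all2_mono)
  qed (use typing_vars[of L \<nu> \<Xi>] in \<open>simp add: \<nu>_def\<close>)
  have wXs: "wf_form L \<Xi> (BAlls \<nu> D ?X)"
    using X D \<nu>W types_W Mem_rels by (auto intro!: wf_form_BAlls)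
  have "wf_form L \<Xi> (interp bi (conclusion \<sigma> B C) e a D)"
    using wf_form_interp[OF wf_form_conclusion[OF \<sigma> B C] e] a D
    by (simp add: witness_types_conclusion[OF semi] \<nu>_def)
  then have wY: "wf_form L (NatT # \<Xi>) ?Y" by (simp add: Y)
  have put: "put 0 m ?Y = BAlls \<nu> D (And (Le (lift ?n m) (lift ?n m)) ?X)"
  proof -
    let ?s = "case_nat m Var :: nat \<Rightarrow> ('g, 'c) tm"
    have s1: "tsub ((up ^^ n) ?s) (lift (n + 1) t) = lift n t" for n t
      using tsub_funpow_up_lift[of n ?s "lift 1 t"] by (simp add: tsub_lift)
    have "put 0 m ?Y = BAlls \<nu> (map (tsub ?s) (map (lift 1) D))
        (fsub ((up ^^ ?n) ?s) (interp bi ?A (lift ?n \<circ> up e) (map (lift (?n + 1)) a) (vars ?n)))"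
      unfolding put_0 by (rule fsub_BAlls) (use D in \<open>auto dest: list_all2_lengthD\<close>)
    also have "map (tsub ?s) (map (lift 1) D) = D"
      using s1[of 0] by (simp add: map_idI)
    also have "fsub ((up ^^ ?n) ?s) (interp bi ?A (lift ?n \<circ> up e) (map (lift (?n + 1)) a) (vars ?n)) =
      interp bi ?A (tsub ((up ^^ ?n) ?s) \<circ> (lift ?n \<circ> up e))
        (map (tsub ((up ^^ ?n) ?s)) (map (lift (?n + 1)) a)) (map (tsub ((up ^^ ?n) ?s)) (vars ?n))"
      by (rule fsub_interp[OF A]) (use a wA in \<open>auto dest: list_all2_lengthD\<close>)
    \<comment> \<open>Index 0 of \<open>up e\<close> is \<open>k\<close>; the result has the form of
      the environment in \<open>interp_bounded\<close>.\<close>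
    also have "tsub ((up ^^ ?n) ?s) \<circ> (lift ?n \<circ> up e) = case_nat (lift ?n m) (lift ?n \<circ> e)"
    proof
      show "(tsub ((up ^^ ?n) ?s) \<circ> (lift ?n \<circ> up e)) i = case_nat (lift ?n m) (lift ?n \<circ> e) i" for i
        using s1[of ?n] by (cases i) (auto simp: funpow_up)
    qed
    also have "map (tsub ((up ^^ ?n) ?s)) (map (lift (?n + 1)) a) = lift ?n m # map (lift ?n) a'"
      using s1 by (simp add: am)
    also have "map (tsub ((up ^^ ?n) ?s)) (vars ?n) = vars ?n"
      by (simp add: funpow_up)
    \<comment> \<open>The first conjunct is the base formula of the \<open>I\<close>-predicate with
      both \<open>k\<close> and its witness equal to \<open>m\<close>; the second is
      \<open>interp_bounded\<close> read from left to right.\<close>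
    also have "interp bi ?A (case_nat (lift ?n m) (lift ?n \<circ> e)) (lift ?n m # map (lift ?n) a') (vars ?n) =
        And (Le (lift ?n m) (lift ?n m)) ?X"
      using interp_bounded[OF semi]
      by (cases "witness_types bi (bounded \<sigma> B C)") (simp add: base_NatT Let_def am)
    finally show ?thesis .
  qed
  have "prov L T (\<nu> @ \<Xi>) {} (Le (lift ?n m) (lift ?n m))"
    by (rule prov_Le_refl[OF _ typing_lift[OF m refl]]) (use \<Xi> \<nu>W types_W in auto)
  then have "prov L T (\<nu> @ \<Xi>) {?X} (And (Le (lift ?n m) (lift ?n m)) ?X)"
    by (rule prov.AndI[OF prov_mono prov.Hyp]) auto
  then have "prov L T (\<nu> @ \<Xi>) {} (Imp ?X (And (Le (lift ?n m) (lift ?n m)) ?X))"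
    using X by (blast intro: prov.ImpI)
  then have "prov L T \<Xi> {} (Imp (BAlls \<nu> D ?X) (BAlls \<nu> D (And (Le (lift ?n m) (lift ?n m)) ?X)))"
    by (rule prov_Imp_BAlls) (use X D \<nu>W types_W Mem_rels in auto)
  then have "prov L T \<Xi> {BAlls \<nu> D ?X} (put 0 m ?Y)"
    unfolding put by (rule prov.ImpE[OF prov_mono]) (auto intro: prov.Hyp)
  then have "prov L T \<Xi> {BAlls \<nu> D ?X} (Ex NatT ?Y)"
    by (rule prov.ExI[OF NatT_L wY m])
  then show ?thesis unfolding Y using wXs by (blast intro: prov.ImpI)
qed

end

section \<open>Closed realizers for the whole principle\<close>

context bounding_interpretation
begin

lemma closed_terms_W: "set \<sigma>s \<subseteq> types W \<Longrightarrow> \<exists>ts. list_all2 (typing W []) ts \<sigma>s"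
proof (induction \<sigma>s)
  case (Cons \<sigma> \<sigma>s)
  then obtain t ts where "typing W [] t \<sigma>" "list_all2 (typing W []) ts \<sigma>s"
    using closed_term_W[of \<sigma>] by auto
  then have "list_all2 (typing W []) (t # ts) (\<sigma> # \<sigma>s)" by simp
  then show ?case by blast
qed auto

lemma wf_form_I_context:
  assumes "set \<Gamma> \<subseteq> types LS"
  shows "wf_form (rel_lang LS) \<Gamma> (I_context \<Gamma>)"
proof -
  have Conjs: "\<forall>A\<in>set As. wf_form R \<Gamma> A \<Longrightarrow> wf_form R \<Gamma> (Conjs As)"
    for R and As :: "('g, 'c, 'r) form list"
    by (induction As rule: Conjs.induct) (auto simp: Top_def)
  show ?thesis
    unfolding I_context_def by (rule Conjs) (use assms in \<open>auto simp: subset_iff intro: typing_Var\<close>)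
qed

text \<open>The negative witnesses of the hypotheses \<open>\<I>(\<^bold>x)\<close> are supplied by arbitrary closed terms \<open>K\<close>; the other
  witnesses are the projections \<open>F\<close> and \<open>G\<close>.\<close>

lemma I_interpretable_collection:
  assumes \<Gamma>: "set \<Gamma> \<subseteq> types LS" and \<sigma>: "\<sigma> \<in> types LS"
    and B: "wf_form (rel_lang LS) (\<sigma> # \<Gamma>) B" and C: "wf_form (rel_lang LS) (NatT # \<sigma> # \<Gamma>) C"
    and semi: "pos bi B = []"
    and A: "relativize A = Imp (premise \<sigma> B C) (conclusion \<sigma> B C)"
  shows "I_interpretable W L T bi \<Gamma> A"
proof -
  let ?I = "I_context \<Gamma> :: ('g, 'c, 'r) form" and ?P = "premise \<sigma> B C" and ?Q = "conclusion \<sigma> B C"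
  define \<iota> \<kappa> \<pi> \<nu> where "\<iota> = pos bi ?I" and "\<kappa> = neg bi ?I" and "\<pi> = pos bi ?P" and "\<nu> = neg bi ?P"
  have wI: "witness_types bi ?I = (\<iota>, \<kappa>)" by (simp add: \<iota>_def \<kappa>_def)
  have wP: "witness_types bi ?P = (\<pi>, \<nu>)" by (simp add: \<pi>_def \<nu>_def)
  have wQ: "witness_types bi ?Q = (\<pi>, map Star \<nu>)"
    using witness_types_conclusion[OF semi, of \<sigma> C] by (simp add: \<pi>_def \<nu>_def prod_eq_iff)
  \<comment> \<open>The negative witnesses of \<open>?A\<close> in order: the positive ones of
    \<open>I_context\<close>, the positive ones of the premise, the negative ones of the
    conclusion.\<close>
  let ?N = "\<iota> @ \<pi> @ map Star \<nu>"
  let ?A = "Imp ?I (Imp ?P ?Q)"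
  have wf: "wf_form (rel_lang LS) \<Gamma> ?I" "wf_form (rel_lang LS) \<Gamma> ?P" "wf_form (rel_lang LS) \<Gamma> ?Q"
    using wf_form_I_context[OF \<Gamma>] wf_form_premise[OF \<sigma> B C] wf_form_conclusion[OF \<sigma> B C] by auto
  have W: "set \<iota> \<subseteq> types W" "set \<kappa> \<subseteq> types W" "set \<pi> \<subseteq> types W" "set \<nu> \<subseteq> types W"
    using witness_types_W[OF wf(1)] witness_types_W[OF wf(2)] by (auto simp: wI wP)
  then have NW: "set ?N \<subseteq> types W" by (auto intro: Star_W)
  \<comment> \<open>\<open>F\<close> selects the block \<open>\<pi>\<close> from
    \<open>\<iota> @ \<pi>\<close>, since positive witnesses of a consequent may not depend on
    negative ones. \<open>G\<close> sees all of \<open>?N\<close> and selects the last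
    block.\<close>
  define F G :: "('g, 'c) tm list" where "F = map (\<lambda>i. proj (\<iota> @ \<pi>) (length \<iota> + i)) [0..<length \<pi>]"
    and "G = map (\<lambda>i. proj ?N (length \<iota> + length \<pi> + i)) [0..<length \<nu>]"
  let ?K = "map (\<lambda>\<tau>. Funs ?N (Star \<tau>)) \<kappa>"
  have "set ?K \<subseteq> types W" using W NW by (auto intro!: Funs_W Star_W simp del: foldr_append)
  then obtain K where K: "list_all2 (typing W []) K ?K" using closed_terms_W by blast
  define ts where "ts = (F @ G) @ K"
  have F: "typing W [] (F ! i) (Funs \<iota> (Funs \<pi> (\<pi> ! i)))" if "i < length \<pi>" for i
    using typing_proj[of "\<iota> @ \<pi>" "length \<iota> + i" "[]"] W that by (simp add: F_def nth_append)
  have G: "typing W [] (G ! i) (Funs \<iota> (Funs (\<pi> @ map Star \<nu>) (Star (\<nu> ! i))))" if "i < length \<nu>" for i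
    using typing_proj[of ?N "length \<iota> + length \<pi> + i" "[]"] NW that
    by (simp add: G_def nth_append)
  have lens: "length F = length \<pi>" "length G = length \<nu>" by (simp_all add: F_def G_def)
  have pos: "pos bi ?A =
      (map (Funs \<iota>) (map (Funs \<pi>) \<pi> @ map (\<lambda>\<tau>. Funs (\<pi> @ map Star \<nu>) (Star \<tau>)) \<nu>)) @ ?K"
    and neg: "neg bi ?A = ?N"
    by (simp_all add: wI wP wQ)
  have "list_all2 (typing W []) (F @ G)
      (map (Funs \<iota>) (map (Funs \<pi>) \<pi> @ map (\<lambda>\<tau>. Funs (\<pi> @ map Star \<nu>) (Star \<tau>)) \<nu>))"
    unfolding map_append
    by (rule list_all2_appendI) (use F G lens in \<open>auto simp: list_all2_conv_all_nth\<close>)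
  then have ts: "list_all2 (typing W []) ts (pos bi ?A)"
    unfolding ts_def pos using K by (rule list_all2_appendI)
  let ?k = "length \<Gamma>" and ?n = "length \<nu>"
  let ?\<Xi> = "\<Gamma> @ ?N"
  \<comment> \<open>The quantifiers \<open>Alls \<Gamma>\<close> belong to the interpreted sentence
    and sit inside those over \<open>?N\<close>; so the context is \<open>\<Gamma> @ ?N\<close>, and
    the variables of \<open>?N\<close> are shifted by \<open>?k\<close>.\<close>
  define e where "e = (up ^^ ?k) (\<lambda>i. Var (i + length ?N) :: ('g, 'c) tm)"
  define q :: "('g, 'c) tm list" where "q = map (lift ?k) (vars (length ?N))"
  have \<Xi>: "set ?\<Xi> \<subseteq> types L" using \<Gamma> NW types_LS types_W by auto
  have e: "subst_ok L \<Gamma> ?\<Xi> e"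
    by (auto simp: e_def subst_ok_def funpow_up nth_append intro!: typing_Var)
  have q: "list_all2 (typing L ?\<Xi>) q ?N"
    using typing_vars[of L ?N "[]"] typing_lift[of L ?N _ _ ?k \<Gamma>]
    unfolding q_def list_all2_map1 by (auto elim!: list_all2_mono simp del: lift_Var)
  have lift_ts: "map (lift ?k) ts = ts"
    using ts by (auto simp: list_all2_conv_all_nth intro!: nth_equalityI lift_closed)
  have ts_L: "list_all2 (typing L ?\<Xi>) ts (pos bi ?A)"
    using ts typing_append[OF typing_mono[OF _ constants_W], of "[]" _ _ ?\<Xi>]
    by (auto elim!: list_all2_mono)
  define a\<^sub>0 d\<^sub>0 where "a\<^sub>0 = take (length \<iota>) q" and "d\<^sub>0 = drop (length \<iota>) q"
  define a D where "a = take (length \<pi>) d\<^sub>0" and "D = drop (length \<pi>) d\<^sub>0"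
  have a0: "list_all2 (typing L ?\<Xi>) a\<^sub>0 \<iota>" and d0: "list_all2 (typing L ?\<Xi>) d\<^sub>0 (\<pi> @ map Star \<nu>)"
    using list_all2_take_drop[OF q] by (auto simp: a\<^sub>0_def d\<^sub>0_def)
  have a: "list_all2 (typing L ?\<Xi>) a \<pi>" and D: "list_all2 (typing L ?\<Xi>) D (map Star \<nu>)"
    using list_all2_take_drop[OF d0] by (auto simp: a_def D_def)
  have split: "d\<^sub>0 = a @ D" by (simp add: a_def D_def)
  \<comment> \<open>The outer implication applies the realizers to \<open>a\<^sub>0\<close>, the
    inner one to the rest. By currying this is one application to the concatenated tuple, which
    \<open>eqv_proj\<close> evaluates.\<close>
  let ?f = "map (\<lambda>h. Apps h a) (map (\<lambda>h. Apps h a\<^sub>0) F)"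
  let ?g = "map (\<lambda>h. Apps h (a @ D)) (map (\<lambda>h. Apps h a\<^sub>0) G)"
  let ?X = "interp bi ?P (lift ?n \<circ> e) (map (lift ?n) a) (vars ?n)"
  have lens': "length a\<^sub>0 = length \<iota>" "length a = length \<pi>" "length D = length \<nu>"
    using a0 a D by (auto dest: list_all2_lengthD)
  have f: "eqv ?\<Xi> (\<pi> ! i) (?f ! i) (a ! i)" if "i < length \<pi>" for i
    using eqv_proj[OF \<Xi>, of "\<iota> @ \<pi>" "length \<iota> + i" "a\<^sub>0 @ a"] a0 a W lens' that
    by (auto simp: F_def nth_append intro: list_all2_appendI)
  have g: "eqv ?\<Xi> (Star (\<nu> ! i)) (?g ! i) (D ! i)" if "i < length \<nu>" for i
    using eqv_proj[OF \<Xi> NW, of "length \<iota> + length \<pi> + i" "a\<^sub>0 @ a @ D"] a0 a D lens' that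
    by (auto simp: G_def nth_append intro!: list_all2_appendI)
  \<comment> \<open>The derivation for the literal \<open>a\<close> and \<open>D\<close> is
    transported to the projections, so the equations are used from right to left.\<close>
  have core: "prov L T ?\<Xi> {} (Imp (BAlls \<nu> ?g ?X) (interp bi ?Q e ?f D))"
  proof (rule prov_Imp_cong[OF \<Xi> _ _ wf(3) e])
    show "wf_form L (\<nu> @ ?\<Xi>) ?X"
      using a typing_lift[of L ?\<Xi> _ _ ?n \<nu>] typing_vars[of L \<nu> ?\<Xi>]
      by (intro wf_form_interp[OF wf(2) subst_ok_lift[OF e]])
        (auto simp: wP list_all2_map1 elim!: list_all2_mono)
    show "prov L T ?\<Xi> {} (Imp (BAlls \<nu> D ?X) (interp bi ?Q e a D))"
      using prov_premise_conclusion[OF \<Xi> e \<sigma> B C semi] a D by (simp add: wP)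
  qed (use W D f g lens lens' in \<open>auto simp: wQ intro: eqv_sym simp del: map_map\<close>)
  have "prov L T ?\<Xi> {} (interp bi (Imp ?P ?Q) e (map (\<lambda>h. Apps h a\<^sub>0) (F @ G)) d\<^sub>0)"
    using core by (simp add: wP wQ Let_def lens lens' split)
  \<comment> \<open>\<open>Z\<close> abbreviates the interpreted \<open>I_context\<close>; its
    well-formedness, which \<open>ImpI\<close> demands, is read off from that of the whole
    formula.\<close>
  moreover obtain Z where
    "interp bi ?A e ts q = Imp Z (interp bi (Imp ?P ?Q) e (map (\<lambda>h. Apps h a\<^sub>0) (F @ G)) d\<^sub>0)"
    using lens by (simp add: wI wP wQ Let_def a\<^sub>0_def d\<^sub>0_def ts_def)
  moreover have "wf_form L ?\<Xi> (interp bi ?A e ts q)"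
    by (rule wf_form_interp[OF _ e ts_L]) (use wf q neg in auto)
  ultimately have "prov L T ?\<Xi> {} (interp bi ?A e ts q)"
    by (auto intro!: prov.ImpI intro: prov_mono)
  then have "prov L T ?N {} (interp bi (Alls \<Gamma> ?A) (\<lambda>i. Var (i + length ?N)) ts (vars (length ?N)))"
    unfolding interp_Alls lift_ts using prov_AllsI[of L T \<Gamma> ?N] \<Gamma> types_LS
    by (simp add: e_def q_def)
  then have "prov L T [] {} (Alls ?N (interp bi (Alls \<Gamma> ?A) (\<lambda>i. Var (i + length ?N)) ts (vars (length ?N))))"
    by (intro prov_AllsI) (use NW types_W in auto)
  then show ?thesis
    unfolding I_interpretable_def U_interpretable_def A witness_types_Alls neg Let_def
    using ts by blast
qed

end

theorem theorem9p13:
  fixes LS LW LT :: "('g, 'c, 'r) lang"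
    and S T :: "('g, 'c, 'r) form set"
    and bi :: "('g, 'c, 'r) base"
    and \<sigma> :: "'g ty" and \<Gamma> \<Delta> :: "'g ty list"
    and B C :: "('g, 'c, 'r) form"
  assumes "HA_extension LS S"
    and "target_theory LS LW LT T"
    and "base_interpretation LS LW LT bi"
    and "bounding_at_NatT bi"
    and "\<sigma> \<in> types LS" and "set \<Gamma> \<subseteq> types LS" and "set \<Delta> \<subseteq> types LS"
    and "wf_form LS (\<sigma> # \<Gamma>) B"
    and "semi_uniform LW LT T bi \<sigma> \<Gamma> B"
    and "wf_form LS (NatT # \<sigma> # \<Gamma> @ \<Delta>) C"
  shows "I_interpretable LW LT T bi (\<Gamma> @ \<Delta>)
    (Imp (RAll \<sigma> B (Ex NatT C))
         (Ex NatT (RAll \<sigma> (weaken 1 B) (REx NatT (Le (Var 0) (Var 2)) (weaken 2 C)))))"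
proof -
  interpret bounding_interpretation LS LW LT T bi S
    using assms by unfold_locales
  \<comment> \<open>\<open>\<Delta>\<close> holds the parameters of \<open>C\<close> beyond
    \<open>n\<close>, \<open>x\<close> and \<open>\<Gamma>\<close>; appended at the end, it does not
    disturb the indices in \<open>B\<close>.\<close>
  have "wf_form LS (\<sigma> # \<Gamma> @ \<Delta>) B" using wf_form_append[OF assms(8), of \<Delta>] by simp
  then show ?thesis
    using assms
    by (intro I_interpretable_collection[OF _ _ _ _ _ relativize_collection])
      (auto simp: semi_uniform_def intro: wf_form_relativize)
qed

end
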